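(* Let $T=\mathbb{Z}$ or $T=\mathbb{R}$ and $\alpha\in(0,2)$. The S$\alpha$S stationary periodic processes $\{X_\alpha(t)\}_{t\in T}$ are not ergodic.
   Context: Notation: $\lambda$ is counting measure on $\mathbb{Z}$ if $T=\mathbb{Z}$ and Lebesgue measure if $T=\mathbb{R}$; $\widehat T=\mathbb{R}$ if $T=\mathbb{R}$, $\widehat T=[0,2\pi)$ if $T=\mathbb{Z}$; $n(t)=0$ if $T=\mathbb{R}$, $n(t)=(-1)^t$ if $T=\mathbb{Z}$; $T_+=(0,\infty)$ if $T=\mathbb{R}$, $T_+=\{2,3,\dots\}$ if $T=\mathbb{Z}$; for $a>0$, $x\in\mathbb{R}$, $[x]_a=\max\{n\in\mathbb{Z}:na\le x\}$, $\{x\}_a=x-a[x]_a$; $Z\times[0,q(\cdot))=\{(z,v):z\in Z,0\le v<q(z)\}$. S$\alpha$S means symmetric $\alpha$-stable. A standard Lebesgue space is a standard Borel space with a $\sigma$-finite measure. Random measures are S$\alpha$S (real-valued, or complex-valued rotationally invariant); $\int_Sf_t\,dM_\alpha$, with $M_\alpha$ having control measure $\nu$ and $f_t\in L^\alpha(S,\nu)$, is the S$\alpha$S process with $E\exp\{i\sum_k\theta_kX(t_k)\}=\exp\{-\int_S|\sum_k\theta_kf_{t_k}|^\alpha d\nu\}$, $\theta_k\in\mathbb{R}$ (real case), or $E\exp\{i\sum_k\Re(\overline{\theta_k}X(t_k))\}=\exp\{-c_0\int_S|\sum_k\overline{\theta_k}f_{t_k}|^\alpha d\nu\}$, $\theta_k\in\mathbb{C}$,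 $c_0=(2\pi)^{-1}\int_0^{2\pi}|\cos\phi|^\alpha d\phi$ (complex case). A stationary periodic process is a stationary stable process which can be represented in distribution (finite-dimensional distributions) as the sum of two independent stationary stable processes: (i) $\int_{\widehat T}e^{itx}N_\alpha(dx)$ (complex case) or $\int_{\{1\}}N_\alpha(dx)+n(t)\int_{\{2\}}N_\alpha(dx)$ (real case), with $N_\alpha$ having a finite control measure; and (ii) $\int_Z\int_{[0,q(z))}b_1(z)^{[v+t]_{q(z)}}g(z,\{v+t\}_{q(z)})M_\alpha(dz,dv)$, where $(Z,\mathcal Z,\sigma)$ is a standard Lebesgue space, $q(z)\in T_+$ a.e. $\sigma(dz)$, $g\in L^\alpha(Z\times[0,q(\cdot)),\sigma(dz)\lambda(dv))$ and $b_1(z)\in\{-1,1\}$ (real case) or $|b_1(z)|=1$ (complex case) are measurable functions, and $M_\alpha$ has control measure $\sigma(dz)\lambda(dv)$. Ergodic means ergodic as a stationary process, i.e. every shift-invariant event of the process has probability $0$ or $1$. *)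

theory Defs
  imports "HOL-Probability.Probability"
begin

text \<open>
  The time set is a set \<open>T\<close> of reals, either \<open>\<int>\<close> or \<open>UNIV\<close>; processes are maps
  \<open>X :: real \<Rightarrow> 'w \<Rightarrow> 'a\<close> of which only the values \<open>X t\<close> with \<open>t \<in> T\<close> matter.
\<close>

section \<open>Time-set conventions\<close>

definition time_measure :: "real set \<Rightarrow> real measure" where
  "time_measure T = (if T = \<int> then count_space \<int> else lborel)"

definition time_dual :: "real set \<Rightarrow> real set" where
  "time_dual T = (if T = \<int> then {0..<2 * pi} else UNIV)"

definition time_pos :: "real set \<Rightarrow> real set" where
  "time_pos T = (if T = \<int> then {t \<in> \<int>. t \<ge> 2} else {0<..})"

definition alt_sign :: "real set \<Rightarrow> real \<Rightarrow> real" where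
  "alt_sign T t = (if T = \<int> then (-1) powi \<lfloor>t\<rfloor> else 0)"

definition wrap_index :: "real \<Rightarrow> real \<Rightarrow> int" where
  "wrap_index a x = (GREATEST n::int. of_int n * a \<le> x)"

definition wrap :: "real \<Rightarrow> real \<Rightarrow> real" where
  "wrap a x = x - a * of_int (wrap_index a x)"

lemma wrap_index_eq_floor: "a > 0 \<Longrightarrow> wrap_index a x = \<lfloor>x / a\<rfloor>"
  unfolding wrap_index_def
  by (rule Greatest_equality) (simp_all add: le_floor_iff flip: pos_le_divide_eq)

definition standard_borel :: "'z measure \<Rightarrow> bool" where
  "standard_borel M \<longleftrightarrow>
     (\<exists>\<tau>. completely_metrizable_space \<tau> \<and> separable_space \<tau> \<and> topspace \<tau> = space M \<and>
          sets M = sigma_sets (topspace \<tau>) {U. openin \<tau> U})"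

definition standard_lebesgue_space :: "'z measure \<Rightarrow> bool" where
  "standard_lebesgue_space M \<longleftrightarrow> standard_borel M \<and> sigma_finite_measure M"

section \<open>Stochastic processes\<close>

definition stochastic_process ::
    "real set \<Rightarrow> 'w measure \<Rightarrow> (real \<Rightarrow> 'w \<Rightarrow> 'a::topological_space) \<Rightarrow> bool" where
  "stochastic_process T P X \<longleftrightarrow> prob_space P \<and> (\<forall>t\<in>T. X t \<in> borel_measurable P)"

definition sample_path :: "real set \<Rightarrow> (real \<Rightarrow> 'w \<Rightarrow> 'a) \<Rightarrow> 'w \<Rightarrow> real \<Rightarrow> 'a" where
  "sample_path T X \<omega> = (\<lambda>t\<in>T. X t \<omega>)"

definition same_fdd :: "real set \<Rightarrow> 'w measure \<Rightarrow> (real \<Rightarrow> 'w \<Rightarrow> 'a::topological_space) \<Rightarrow>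
    'v measure \<Rightarrow> (real \<Rightarrow> 'v \<Rightarrow> 'a) \<Rightarrow> bool" where
  "same_fdd T P X Q Y \<longleftrightarrow>
     (\<forall>K. finite K \<and> K \<subseteq> T \<longrightarrow>
        distr P (\<Pi>\<^sub>M t\<in>K. borel) (sample_path K X) = distr Q (\<Pi>\<^sub>M t\<in>K. borel) (sample_path K Y))"

definition stationary ::
    "real set \<Rightarrow> 'w measure \<Rightarrow> (real \<Rightarrow> 'w \<Rightarrow> 'a::topological_space) \<Rightarrow> bool" where
  "stationary T P X \<longleftrightarrow> (\<forall>h\<in>T. same_fdd T P (\<lambda>t. X (t + h)) P X)"

text \<open>
  An event of the process is \<open>{\<omega>. sample_path T X \<omega> \<in> A}\<close> with \<open>A\<close> in the product \<open>\<sigma>\<close>-algebra.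
  Invariance is up to null sets: for \<open>T = UNIV\<close> a set in the product \<open>\<sigma>\<close>-algebra depends on
  countably many coordinates only, so the sets that are pointwise invariant under all shifts
  are just the empty set and the whole space; for \<open>T = \<int>\<close> and a stationary process the two
  readings of invariance give the same notion of ergodicity.
\<close>

definition ergodic ::
    "real set \<Rightarrow> 'w measure \<Rightarrow> (real \<Rightarrow> 'w \<Rightarrow> 'a::topological_space) \<Rightarrow> bool" where
  "ergodic T P X \<longleftrightarrow>
     (\<forall>A \<in> sets (\<Pi>\<^sub>M t\<in>T. borel).
        (\<forall>h\<in>T. AE \<omega> in P. sample_path T (\<lambda>t. X (t + h)) \<omega> \<in> A \<longleftrightarrow> sample_path T X \<omega> \<in> A) \<longrightarrow>
        measure P {\<omega> \<in> space P. sample_path T X \<omega> \<in> A} \<in> {0, 1})"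

section \<open>Symmetric stable processes and stable integrals\<close>

definition sas_real :: "real set \<Rightarrow> real \<Rightarrow> 'w measure \<Rightarrow> (real \<Rightarrow> 'w \<Rightarrow> real) \<Rightarrow> bool" where
  "sas_real T \<alpha> P X \<longleftrightarrow>
     (\<forall>K \<theta>. finite K \<and> K \<subseteq> T \<longrightarrow>
        (\<exists>c\<ge>0. \<forall>u. (\<integral>\<omega>. iexp (u * (\<Sum>t\<in>K. \<theta> t * X t \<omega>)) \<partial>P)
                    = complex_of_real (exp (- (c * \<bar>u\<bar> powr \<alpha>)))))"

text \<open>
  In the complex case \<open>u\<close> is complex, and its argument plays no role on the right-hand side:
  this expresses the rotational invariance of the finite-dimensional distributions.
\<close>

definition sas_complex :: "real set \<Rightarrow> real \<Rightarrow> 'w measure \<Rightarrow> (real \<Rightarrow> 'w \<Rightarrow> complex) \<Rightarrow> bool" where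
  "sas_complex T \<alpha> P X \<longleftrightarrow>
     (\<forall>K \<theta>. finite K \<and> K \<subseteq> T \<longrightarrow>
        (\<exists>c\<ge>0. \<forall>u. (\<integral>\<omega>. iexp (Re (cnj u * (\<Sum>t\<in>K. cnj (\<theta> t) * X t \<omega>))) \<partial>P)
                    = complex_of_real (exp (- (c * cmod u powr \<alpha>)))))"

definition stationary_sas_real ::
    "real set \<Rightarrow> real \<Rightarrow> 'w measure \<Rightarrow> (real \<Rightarrow> 'w \<Rightarrow> real) \<Rightarrow> bool" where
  "stationary_sas_real T \<alpha> P X \<longleftrightarrow>
     stochastic_process T P X \<and> stationary T P X \<and> sas_real T \<alpha> P X"

definition stationary_sas_complex ::
    "real set \<Rightarrow> real \<Rightarrow> 'w measure \<Rightarrow> (real \<Rightarrow> 'w \<Rightarrow> complex) \<Rightarrow> bool" where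
  "stationary_sas_complex T \<alpha> P X \<longleftrightarrow>
     stochastic_process T P X \<and> stationary T P X \<and> sas_complex T \<alpha> P X"

definition in_L :: "real \<Rightarrow> 's measure \<Rightarrow> ('s \<Rightarrow> 'a::real_normed_vector) \<Rightarrow> bool" where
  "in_L \<alpha> \<nu> f \<longleftrightarrow> f \<in> borel_measurable \<nu> \<and> integrable \<nu> (\<lambda>s. norm (f s) powr \<alpha>)"

text \<open>
  \<open>X\<close> is the process \<open>X t = \<integral> f t dM\<close>, where \<open>M\<close> is the symmetric \<open>\<alpha>\<close>-stable random measure with
  control measure \<open>\<nu>\<close>, specified by its finite-dimensional characteristic functions.
  The times \<open>t\<^sub>k\<close> are taken distinct, as the elements of a finite set \<open>K\<close>.
\<close>

definition stable_integral_real :: "real set \<Rightarrow> real \<Rightarrow> 's measure \<Rightarrow> (real \<Rightarrow> 's \<Rightarrow> real) \<Rightarrow>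
    'w measure \<Rightarrow> (real \<Rightarrow> 'w \<Rightarrow> real) \<Rightarrow> bool" where
  "stable_integral_real T \<alpha> \<nu> f P X \<longleftrightarrow>
     (\<forall>t\<in>T. in_L \<alpha> \<nu> (f t)) \<and>
     (\<forall>K \<theta>. finite K \<and> K \<subseteq> T \<longrightarrow>
        (\<integral>\<omega>. iexp (\<Sum>t\<in>K. \<theta> t * X t \<omega>) \<partial>P)
        = complex_of_real (exp (- (\<integral>s. \<bar>\<Sum>t\<in>K. \<theta> t * f t s\<bar> powr \<alpha> \<partial>\<nu>))))"

definition c0 :: "real \<Rightarrow> real" where
  "c0 \<alpha> = inverse (2 * pi) * (LBINT \<phi>:{0..2 * pi}. \<bar>cos \<phi>\<bar> powr \<alpha>)"

definition stable_integral_complex :: "real set \<Rightarrow> real \<Rightarrow> 's measure \<Rightarrow> (real \<Rightarrow> 's \<Rightarrow> complex) \<Rightarrow>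
    'w measure \<Rightarrow> (real \<Rightarrow> 'w \<Rightarrow> complex) \<Rightarrow> bool" where
  "stable_integral_complex T \<alpha> \<nu> f P X \<longleftrightarrow>
     (\<forall>t\<in>T. in_L \<alpha> \<nu> (f t)) \<and>
     (\<forall>K \<theta>. finite K \<and> K \<subseteq> T \<longrightarrow>
        (\<integral>\<omega>. iexp (\<Sum>t\<in>K. Re (cnj (\<theta> t) * X t \<omega>)) \<partial>P)
        = complex_of_real
            (exp (- (c0 \<alpha> * (\<integral>s. cmod (\<Sum>t\<in>K. cnj (\<theta> t) * f t s) powr \<alpha> \<partial>\<nu>)))))"

section \<open>Stationary periodic processes\<close>

subsection \<open>Harmonizable part\<close>

text \<open>
  Real case: the control measure lives on \<open>{1, 2}\<close>, and
  \<open>\<integral>\<^bsub>{1}\<^esub> dN + n(t) \<integral>\<^bsub>{2}\<^esub> dN\<close> is the integral of \<open>indicator {1} + n(t) indicator {2}\<close>.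
\<close>

definition harmonizable_part_real ::
    "real set \<Rightarrow> real \<Rightarrow> 'w measure \<Rightarrow> (real \<Rightarrow> 'w \<Rightarrow> real) \<Rightarrow> bool" where
  "harmonizable_part_real T \<alpha> P X \<longleftrightarrow>
     (\<exists>\<mu> :: nat measure. finite_measure \<mu> \<and> space \<mu> = {1, 2} \<and> sets \<mu> = Pow {1, 2} \<and>
        stable_integral_real T \<alpha> \<mu>
          (\<lambda>t s. indicator {1} s + alt_sign T t * indicator {2} s) P X)"

definition harmonizable_part_complex ::
    "real set \<Rightarrow> real \<Rightarrow> 'w measure \<Rightarrow> (real \<Rightarrow> 'w \<Rightarrow> complex) \<Rightarrow> bool" where
  "harmonizable_part_complex T \<alpha> P X \<longleftrightarrow>
     (\<exists>\<mu> :: real measure. finite_measure \<mu> \<and>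
        space \<mu> = time_dual T \<and> sets \<mu> = sets (restrict_space borel (time_dual T)) \<and>
        stable_integral_complex T \<alpha> \<mu> (\<lambda>t x. iexp (t * x)) P X)"

subsection \<open>Cyclic part\<close>

definition cyclic_space ::
    "real set \<Rightarrow> 'z measure \<Rightarrow> ('z \<Rightarrow> real) \<Rightarrow> ('z \<times> real) measure" where
  "cyclic_space T \<sigma> q =
     restrict_space (\<sigma> \<Otimes>\<^sub>M time_measure T)
       {(z, v). z \<in> space \<sigma> \<and> v \<in> T \<and> 0 \<le> v \<and> v < q z}"

definition cyclic_kernel :: "('z \<Rightarrow> real) \<Rightarrow> ('z \<Rightarrow> 'a::real_normed_field) \<Rightarrow>
    ('z \<times> real \<Rightarrow> 'a) \<Rightarrow> real \<Rightarrow> 'z \<times> real \<Rightarrow> 'a" where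
  "cyclic_kernel q b g t =
     (\<lambda>(z, v). b z powi wrap_index (q z) (v + t) * g (z, wrap (q z) (v + t)))"

text \<open>
  The argument of type \<open>'z itself\<close> only provides the carrier type of the standard Lebesgue
  space, over which HOL cannot quantify inside a definition.
\<close>

definition cyclic_part_real ::
    "'z itself \<Rightarrow> real set \<Rightarrow> real \<Rightarrow> 'w measure \<Rightarrow> (real \<Rightarrow> 'w \<Rightarrow> real) \<Rightarrow> bool" where
  "cyclic_part_real TZ T \<alpha> P X \<longleftrightarrow>
     (\<exists>(\<sigma> :: 'z measure) q g b.
        standard_lebesgue_space \<sigma> \<and>
        q \<in> borel_measurable \<sigma> \<and> (AE z in \<sigma>. q z \<in> time_pos T) \<and>
        in_L \<alpha> (cyclic_space T \<sigma> q) g \<and>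
        b \<in> borel_measurable \<sigma> \<and> (\<forall>z\<in>space \<sigma>. b z \<in> {-1, 1}) \<and>
        stable_integral_real T \<alpha> (cyclic_space T \<sigma> q) (cyclic_kernel q b g) P X)"

definition cyclic_part_complex ::
    "'z itself \<Rightarrow> real set \<Rightarrow> real \<Rightarrow> 'w measure \<Rightarrow> (real \<Rightarrow> 'w \<Rightarrow> complex) \<Rightarrow> bool" where
  "cyclic_part_complex TZ T \<alpha> P X \<longleftrightarrow>
     (\<exists>(\<sigma> :: 'z measure) q g b.
        standard_lebesgue_space \<sigma> \<and>
        q \<in> borel_measurable \<sigma> \<and> (AE z in \<sigma>. q z \<in> time_pos T) \<and>
        in_L \<alpha> (cyclic_space T \<sigma> q) g \<and>
        b \<in> borel_measurable \<sigma> \<and> (\<forall>z\<in>space \<sigma>. cmod (b z) = 1) \<and>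
        stable_integral_complex T \<alpha> (cyclic_space T \<sigma> q) (cyclic_kernel q b g) P X)"

subsection \<open>The sum\<close>

text \<open>
  As above, the type arguments provide the carrier of the standard Lebesgue space and the
  sample space of the two independent summands \<open>Y\<^sub>1\<close> and \<open>Y\<^sub>2\<close>.
\<close>

definition stationary_periodic_real :: "'z itself \<Rightarrow> 'v itself \<Rightarrow>
    real set \<Rightarrow> real \<Rightarrow> 'w measure \<Rightarrow> (real \<Rightarrow> 'w \<Rightarrow> real) \<Rightarrow> bool" where
  "stationary_periodic_real TZ TV T \<alpha> P X \<longleftrightarrow>
     stationary_sas_real T \<alpha> P X \<and>
     (\<exists>(Q :: 'v measure) Y\<^sub>1 Y\<^sub>2.
        stationary_sas_real T \<alpha> Q Y\<^sub>1 \<and> stationary_sas_real T \<alpha> Q Y\<^sub>2 \<and>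
        prob_space.indep_var Q (\<Pi>\<^sub>M t\<in>T. borel) (sample_path T Y\<^sub>1)
          (\<Pi>\<^sub>M t\<in>T. borel) (sample_path T Y\<^sub>2) \<and>
        harmonizable_part_real T \<alpha> Q Y\<^sub>1 \<and> cyclic_part_real TZ T \<alpha> Q Y\<^sub>2 \<and>
        same_fdd T P X Q (\<lambda>t \<omega>. Y\<^sub>1 t \<omega> + Y\<^sub>2 t \<omega>))"

definition stationary_periodic_complex :: "'z itself \<Rightarrow> 'v itself \<Rightarrow>
    real set \<Rightarrow> real \<Rightarrow> 'w measure \<Rightarrow> (real \<Rightarrow> 'w \<Rightarrow> complex) \<Rightarrow> bool" where
  "stationary_periodic_complex TZ TV T \<alpha> P X \<longleftrightarrow>
     stationary_sas_complex T \<alpha> P X \<and>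
     (\<exists>(Q :: 'v measure) Y\<^sub>1 Y\<^sub>2.
        stationary_sas_complex T \<alpha> Q Y\<^sub>1 \<and> stationary_sas_complex T \<alpha> Q Y\<^sub>2 \<and>
        prob_space.indep_var Q (\<Pi>\<^sub>M t\<in>T. borel) (sample_path T Y\<^sub>1)
          (\<Pi>\<^sub>M t\<in>T. borel) (sample_path T Y\<^sub>2) \<and>
        harmonizable_part_complex T \<alpha> Q Y\<^sub>1 \<and> cyclic_part_complex TZ T \<alpha> Q Y\<^sub>2 \<and>
        same_fdd T P X Q (\<lambda>t \<omega>. Y\<^sub>1 t \<omega> + Y\<^sub>2 t \<omega>))"

text \<open>
  The identically zero process has representations of this form (all control measures zero)
  and is trivially ergodic.
\<close>

definition nondegenerate ::
    "real set \<Rightarrow> 'w measure \<Rightarrow> (real \<Rightarrow> 'w \<Rightarrow> 'a::zero) \<Rightarrow> bool" where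
  "nondegenerate T P X \<longleftrightarrow> \<not> (\<forall>t\<in>T. AE \<omega> in P. X t \<omega> = 0)"

end

theory Submission
  imports Defs
begin

text \<open>
  If \<open>X\<close> were ergodic, the constant \<open>E exp (i X t)\<close> would be an \<open>L\<^sup>2\<close> limit of convex
  combinations \<open>\<Sum> w\<^sub>k exp (i X t\<^sub>k)\<close>, whose squared norms are \<open>\<Sum> w\<^sub>k w\<^sub>l exp (- d\<^sub>k\<^sub>l)\<close> with
  \<open>d\<^sub>k\<^sub>l = \<integral> |f t\<^sub>k - f t\<^sub>l|\<^sup>\<alpha>\<close>. So the infimum of these would be \<open>exp (- 2 c)\<close>, where
  \<open>c = \<integral> |f t|\<^sup>\<alpha>\<close>. By convexity it is enough to show that \<open>\<Sum> w\<^sub>k w\<^sub>l d\<^sub>k\<^sub>l \<le> 2 c - \<delta>\<close> with some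
  \<open>\<delta> > 0\<close> independent of the weights and times.

  As \<open>\<alpha> < 2\<close>, the function \<open>|x|\<^sup>\<alpha>\<close> is a mixture of \<open>1 - exp (- s |x|\<^sup>2)\<close>, and positive
  definiteness of Gaussian kernels gives
  \<open>\<Sum> w\<^sub>k w\<^sub>l |x\<^sub>k - x\<^sub>l|\<^sup>\<alpha> \<le> 2 \<Sum> w\<^sub>k |x\<^sub>k|\<^sup>\<alpha> - \<kappa> (\<Sum> w\<^sub>k h x\<^sub>k)\<^sup>2\<close> with \<open>h x = 1 - exp (- |x|\<^sup>2)\<close>.
  For the harmonizable part \<open>|f t|\<close> does not depend on \<open>t\<close>; for the cyclic part the integral of
  \<open>h (f t)\<close> over each periodic orbit does not. Either way the integral of the last square is
  bounded below uniformly.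
\<close>

section \<open>Conditional negativity of the power of the norm\<close>

text \<open>For exponent 2 the gain over \<open>2 \<Sum> w |x|^2\<close> is
  \<open>2 |\<Sum> w x|^2\<close>, which cancellation along an orbit can destroy. Subordination
  replaces x by the nonnegative \<open>h x\<close>, and nothing cancels in an average of nonnegative
  terms. The obstacle is then that the control measure of the cyclic part may be infinite. To bound
  the integral of the squared average from below, Cauchy-Schwarz is applied against a weight:
  positive, so that nothing is lost; square integrable, so that the bound is finite; and constant on
  orbits, so that the weighted integral of \<open>h (f t)\<close> still does not depend on t. This
  is \<open>invariant_weight\<close>. Independence multiplies characteristic functions, so c, d and
  \<delta> add over the two summands. One summand may vanish, so each gap is only required to be
  positive when its own c is nonzero; nondegeneracy of the sum does the rest. The complex case is
  reduced to real parts: ergodicity passes to coordinatewise images, and rotational invariance keeps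
  the real part nontrivial.\<close>

text \<open>Schur product argument, one coordinate at a time: in the Taylor series of
  \<open>exp (y i b * y j b)\<close> the n-th term is a quadratic form of the same kind with
  \<open>a i\<close> replaced by \<open>a i * y i b ^ n\<close>, hence nonnegative by
  induction.\<close>

lemma sum_exp_inner_ge:
  fixes y :: "'i \<Rightarrow> 'b \<Rightarrow> real"
  assumes "finite B" "finite I"
  shows "(\<Sum>i\<in>I. a i)\<^sup>2 \<le> (\<Sum>i\<in>I. \<Sum>j\<in>I. a i * a j * exp (\<Sum>b\<in>B. y i b * y j b))"
  using assms(1)
proof (induction B arbitrary: a rule: finite_induct)
  case empty
  then show ?case by (simp add: power2_eq_square sum_product)
next
  case (insert b B)
  define r where "r i j = (\<Sum>b\<in>B. y i b * y j b)" for i j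
  define t where "t n = (\<Sum>i\<in>I. \<Sum>j\<in>I. (a i * y i b ^ n) * (a j * y j b ^ n) * exp (r i j)) / fact n" for n
  have "(\<lambda>n. \<Sum>i\<in>I. \<Sum>j\<in>I. a i * a j * exp (r i j) * ((y i b * y j b) ^ n /\<^sub>R fact n))
      sums (\<Sum>i\<in>I. \<Sum>j\<in>I. a i * a j * exp (r i j) * exp (y i b * y j b))"
    by (intro sums_sum sums_mult exp_converges)
  also have "(\<lambda>n. \<Sum>i\<in>I. \<Sum>j\<in>I. a i * a j * exp (r i j) * ((y i b * y j b) ^ n /\<^sub>R fact n)) = t"
    by (auto simp: t_def fun_eq_iff sum_divide_distrib field_simps
        intro!: sum.cong)
  also have "(\<Sum>i\<in>I. \<Sum>j\<in>I. a i * a j * exp (r i j) * exp (y i b * y j b))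
      = (\<Sum>i\<in>I. \<Sum>j\<in>I. a i * a j * exp (\<Sum>b\<in>insert b B. y i b * y j b))"
    using insert.hyps by (simp add: r_def exp_add mult_ac)
  finally have t: "t sums (\<Sum>i\<in>I. \<Sum>j\<in>I. a i * a j * exp (\<Sum>b\<in>insert b B. y i b * y j b))" .
  have ge: "(\<Sum>i\<in>I. a i * y i b ^ n)\<^sup>2 / fact n \<le> t n" for n
    unfolding t_def r_def by (intro divide_right_mono insert.IH) auto
  have "t n \<ge> 0" for n
    using ge[of n] by (rule order_trans[rotated]) auto
  \<comment> \<open>All terms are nonnegative, and the term n = 0 has the unchanged coefficients
    \<open>a\<close>, so it alone already gives the bound.\<close>
  then have "t 0 \<le> suminf t"
    using sum_le_suminf[OF sums_summable[OF t], of "{0}"] by auto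
  with ge[of 0] t show ?case
    by (simp add: sums_iff)
qed

text \<open>Expanding the square of the distance splits the kernel into two factors absorbed by the
  weights and \<open>exp (2 * s * (x i \<bullet> x j))\<close>. The left side is the Schur
  complement term that comes from adjoining the origin to the points.\<close>

lemma gaussian_kernel_ge:
  fixes x :: "'i \<Rightarrow> 'b::euclidean_space"
  assumes "finite I" "0 \<le> s"
  shows "(\<Sum>i\<in>I. w i * exp (- s * (norm (x i))\<^sup>2))\<^sup>2
    \<le> (\<Sum>i\<in>I. \<Sum>j\<in>I. w i * w j * exp (- s * (norm (x i - x j))\<^sup>2))"
proof -
  let ?y = "\<lambda>i b. sqrt (2 * s) * (x i \<bullet> b)"
  have *: "(\<Sum>b\<in>Basis. ?y i b * ?y j b) = 2 * s * (x i \<bullet> x j)" for i j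
  proof -
    have "(\<Sum>b\<in>Basis. ?y i b * ?y j b) = (\<Sum>b\<in>Basis. 2 * s * ((x i \<bullet> b) * (x j \<bullet> b)))"
      using assms by (intro sum.cong) (auto simp: algebra_simps)
    then show ?thesis
      by (subst euclidean_inner) (simp add: sum_distrib_left)
  qed
  have "(\<Sum>i\<in>I. w i * exp (- s * (norm (x i))\<^sup>2))\<^sup>2
    \<le> (\<Sum>i\<in>I. \<Sum>j\<in>I. (w i * exp (- s * (norm (x i))\<^sup>2)) * (w j * exp (- s * (norm (x j))\<^sup>2))
          * exp (\<Sum>b\<in>Basis. ?y i b * ?y j b))"
    using assms by (intro sum_exp_inner_ge) auto
  also have "\<dots> = (\<Sum>i\<in>I. \<Sum>j\<in>I. w i * w j * exp (- s * (norm (x i - x j))\<^sup>2))"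
  proof (intro sum.cong refl)
    fix i j
    have "- s * (norm (x i - x j))\<^sup>2 = (- s * (norm (x i))\<^sup>2) + (- s * (norm (x j))\<^sup>2) + 2 * s * (x i \<bullet> x j)"
      by (simp add: power2_norm_eq_inner inner_commute algebra_simps)
    then have "exp (- s * (norm (x i - x j))\<^sup>2) = exp (- s * (norm (x i))\<^sup>2) * exp (- s * (norm (x j))\<^sup>2) * exp (2 * s * (x i \<bullet> x j))"
      by (simp only: exp_add)
    then show "(w i * exp (- s * (norm (x i))\<^sup>2)) * (w j * exp (- s * (norm (x j))\<^sup>2))
          * exp (\<Sum>b\<in>Basis. ?y i b * ?y j b) = w i * w j * exp (- s * (norm (x i - x j))\<^sup>2)"
      unfolding * by simp
  qed
  finally show ?thesis .
qed

text \<open>The constant comes from substituting \<open>s = u / y\<close>.\<close>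

lemma powr_subordination:
  fixes \<beta> :: real
  assumes "0 < \<beta>" "\<beta> < 1"
  obtains C where "C > 0" and
    "\<And>y. 0 \<le> y \<Longrightarrow> has_bochner_integral lborel
       (\<lambda>s. (1 - exp (- s * y)) * (indicator {0<..} s * s powr (- 1 - \<beta>))) (C * y powr \<beta>)"
proof -
  define k :: "real \<Rightarrow> real" where "k s = indicator {0<..} s * s powr (- 1 - \<beta>)" for s
  have k_nonneg: "k s \<ge> 0" for s by (simp add: k_def)
  have [measurable]: "k \<in> borel_measurable borel" unfolding k_def by measurable
  have f_nonneg: "0 \<le> (1 - exp (- s * y)) * k s" if "0 \<le> y" for s y
    using that by (auto simp: k_def indicator_def)
  define J where "J y = (\<integral>\<^sup>+s. (1 - exp (- s * y)) * k s \<partial>lborel)" for y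
  have J_scale: "J y = ennreal (y powr \<beta>) * J 1" if "y > 0" for y
  proof -
    have "J y = ennreal \<bar>1 / y\<bar> * (\<integral>\<^sup>+s. (1 - exp (- (0 + 1 / y * s) * y)) * k (0 + 1 / y * s) \<partial>lborel)"
      unfolding J_def using that by (intro nn_integral_real_affine) auto
    also have "\<dots> = (\<integral>\<^sup>+s. ennreal (1 / y) * ennreal ((1 - exp (- (0 + 1 / y * s) * y)) * k (0 + 1 / y * s)) \<partial>lborel)"
      using that by (subst nn_integral_cmult) auto
    also have "\<dots> = (\<integral>\<^sup>+s. ennreal (y powr \<beta>) * ennreal ((1 - exp (- s * 1)) * k s) \<partial>lborel)"
    proof (intro nn_integral_cong)
      fix s :: real
      have "(1 / y) * k (1 / y * s) = y powr \<beta> * k s"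
      proof (cases "s > 0")
        case True
        then have "k (1 / y * s) = s powr (- 1 - \<beta>) * y powr (1 + \<beta>)"
          using that by (simp add: k_def powr_divide powr_minus powr_diff field_simps powr_add)
        then show ?thesis using that True by (simp add: powr_add k_def)
      qed (use that in \<open>auto simp: k_def indicator_def field_simps\<close>)
      moreover have "exp (- (0 + 1 / y * s) * y) = exp (- s * 1)"
        using that by simp
      ultimately have "1 / y * ((1 - exp (- (0 + 1 / y * s) * y)) * k (0 + 1 / y * s)) = y powr \<beta> * ((1 - exp (- s * 1)) * k s)"
        unfolding mult.left_commute[of "1 / y"] mult.left_commute[of "y powr \<beta>"] by simp
      then show "ennreal (1 / y) * ennreal ((1 - exp (- (0 + 1 / y * s) * y)) * k (0 + 1 / y * s)) = ennreal (y powr \<beta>) * ennreal ((1 - exp (- s * 1)) * k s)"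
        using that by (simp only: ennreal_mult'[symmetric] powr_ge_zero divide_nonneg_pos zero_le_one)
    qed
    also have "\<dots> = ennreal (y powr \<beta>) * J 1"
      unfolding J_def by (subst nn_integral_cmult) auto
    finally show ?thesis .
  qed
  \<comment> \<open>Near 0 the bound \<open>1 - exp (- s) \<le> s\<close> leaves
    \<open>s powr (- \<beta>)\<close>, integrable because \<beta> < 1; near infinity the bound 1
    leaves \<open>s powr (- 1 - \<beta>)\<close>, integrable because 0 < \<beta>.\<close>
  have "J 1 \<le> (\<integral>\<^sup>+s. indicator {0..1} s * ennreal (s powr (- \<beta>)) + ennreal (s powr (- 1 - \<beta>)) * indicator {1..} s \<partial>lborel)"
    unfolding J_def
  proof (intro nn_integral_mono)
    fix s :: real
    consider "s \<le> 0" | "0 < s" "s < 1" | "1 \<le> s" by linarith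
    then show "ennreal ((1 - exp (- s * 1)) * k s) \<le> indicator {0..1} s * ennreal (s powr (- \<beta>)) + ennreal (s powr (- 1 - \<beta>)) * indicator {1..} s"
    proof cases
      case 2
      have "(1 - exp (- s)) \<le> s" using exp_ge_add_one_self[of "-s"] by simp
      then have "(1 - exp (- s)) * k s \<le> s * s powr (- 1 - \<beta>)"
        using 2 by (auto simp: k_def)
      also have "\<dots> = s powr (- \<beta>)"
        using 2 powr_mult_base[of s "-1-\<beta>"] by simp
      finally show ?thesis using 2 by (simp add: ennreal_leI)
    next
      case 3
      then have "(1 - exp (- s)) * k s \<le> 1 * s powr (- 1 - \<beta>)"
        by (intro mult_mono) (auto simp: k_def)
      then show ?thesis using 3 by (auto simp: ennreal_leI intro: add_increasing)
    qed (simp add: k_def)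
  qed
  also have "\<dots> = (\<integral>\<^sup>+s. indicator {0..1} s * ennreal (s powr (- \<beta>)) \<partial>lborel)
      + (\<integral>\<^sup>+s. ennreal (s powr (- 1 - \<beta>)) * indicator {1..} s \<partial>lborel)"
    by (subst nn_integral_add) auto
  also have "\<dots> < \<infinity>"
  proof -
    have "(\<lambda>x. x powr (- \<beta>)) integrable_on {0..1}"
      using assms by (intro integrable_on_powr_from_0) auto
    then obtain I where I: "((\<lambda>x. x powr (- \<beta>)) has_integral I) {0..1::real}"
      by (auto simp: integrable_on_def)
    have "(\<integral>\<^sup>+s. indicator {0..1} s * ennreal (s powr (- \<beta>)) \<partial>lborel)
       = integral\<^sup>N lborel (\<lambda>x. indicator {0..1} x * x powr (- \<beta>))"
      by (intro nn_integral_cong) (auto simp: indicator_def)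
    also have "\<dots> = ennreal I"
      by (intro nn_integral_has_integral_lebesgue I) auto
    finally have 1: "(\<integral>\<^sup>+s. indicator {0..1} s * ennreal (s powr (- \<beta>)) \<partial>lborel) < \<infinity>" by simp
    have "((\<lambda>x. x powr (- 1 - \<beta>)) has_integral - (1 powr (- 1 - \<beta> + 1)) / (- 1 - \<beta> + 1)) {1..}"
      using assms by (intro has_integral_powr_to_inf) auto
    then have "integral\<^sup>N lborel (\<lambda>x. indicator {1..} x * x powr (- 1 - \<beta>)) < \<infinity>"
      by (subst nn_integral_has_integral_lebesgue) auto
    also have "integral\<^sup>N lborel (\<lambda>x. indicator {1..} x * x powr (- 1 - \<beta>))
        = (\<integral>\<^sup>+s. ennreal (s powr (- 1 - \<beta>)) * indicator {1..} s \<partial>lborel)"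
      by (intro nn_integral_cong) (auto simp: indicator_def)
    finally have "(\<integral>\<^sup>+s. ennreal (s powr (- 1 - \<beta>)) * indicator {1..} s \<partial>lborel) < \<infinity>" .
    with 1 show ?thesis by simp
  qed
  finally have fin: "J 1 < \<infinity>" .
  have pos: "J 1 \<noteq> 0"
  proof
    assume "J 1 = 0"
    then have "AE s in lborel. ennreal ((1 - exp (- s * 1)) * k s) = 0"
      unfolding J_def by (subst (asm) nn_integral_0_iff_AE) auto
    then have "AE s in lborel. s \<notin> {0<..<1::real}"
      by (rule AE_mp) (auto simp: k_def indicator_def ennreal_eq_0_iff mult_le_0_iff)
    then have "{0<..<1::real} \<in> null_sets lborel"
      by (subst AE_iff_null_sets) auto
    then show False by (simp add: null_sets_def)
  qed
  define C where "C = enn2real (J 1)"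
  have C: "J 1 = ennreal C" "C > 0"
    using fin pos by (auto simp: C_def enn2real_positive_iff less_top zero_less_iff_neq_zero)
  show thesis
  proof (rule that[OF \<open>C > 0\<close>])
    fix y :: real assume y: "0 \<le> y"
    have "J y = ennreal (C * y powr \<beta>)"
    proof (cases "y = 0")
      case False
      with y have "y > 0" by simp
      from J_scale[OF this] C show ?thesis by (simp add: ennreal_mult' mult.commute)
    qed (use assms in \<open>simp add: J_def\<close>)
    then show "has_bochner_integral lborel
       (\<lambda>s. (1 - exp (- s * y)) * (indicator {0<..} s * s powr (- 1 - \<beta>))) (C * y powr \<beta>)"
      using f_nonneg[OF y] C unfolding J_def k_def
      by (intro has_bochner_integral_nn_integral) auto
  qed
qed

text \<open>Convexity of exp on the segment from 0 to - y. It compares the Gaussian of scale s with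
  the one of scale 1, so that a single function \<open>h\<close> serves for a whole range of
  scales.\<close>

lemma exp_chord_le:
  fixes s y :: real
  assumes "0 \<le> s" "s \<le> 1"
  shows "s * (1 - exp (- y)) \<le> 1 - exp (- s * y)"
  using convex_onD[OF exp_convex, of s 0 "- y"] assms by (simp add: algebra_simps)

text \<open>
  Negative definiteness of \<open>|x|\<^sup>\<alpha>\<close> would only give \<open>2 \<Sum> w |x|\<^sup>\<alpha>\<close> on the right; the
  quantitative gain is what survives after averaging over a periodic orbit.
\<close>

lemma norm_powr_conditionally_negative:
  assumes "0 < \<alpha>" "\<alpha> < 2"
  shows "\<exists>\<kappa>>0. \<forall>I w (x :: 'i \<Rightarrow> 'b::euclidean_space).
      finite I \<longrightarrow> (\<forall>i\<in>I. 0 \<le> w i) \<longrightarrow> sum w I = 1 \<longrightarrow>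
      (\<Sum>i\<in>I. \<Sum>j\<in>I. w i * w j * norm (x i - x j) powr \<alpha>)
      \<le> 2 * (\<Sum>i\<in>I. w i * norm (x i) powr \<alpha>) - \<kappa> * (\<Sum>i\<in>I. w i * (1 - exp (- (norm (x i))\<^sup>2)))\<^sup>2"
proof -
  define k :: "real \<Rightarrow> real" where "k s = indicator {0<..} s * s powr (- 1 - \<alpha> / 2)" for s
  obtain C where C: "C > 0"
    and k: "\<And>y. 0 \<le> y \<Longrightarrow> has_bochner_integral lborel (\<lambda>s. (1 - exp (- s * y)) * k s) (C * y powr (\<alpha> / 2))"
    using powr_subordination[of "\<alpha> / 2"] assms unfolding k_def by auto
  have powr2: "((norm z)\<^sup>2) powr (\<alpha> / 2) = norm z powr \<alpha>" for z :: 'b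
    by (cases "z = 0") (simp_all add: powr_powr flip: powr_numeral)
  have k': "has_bochner_integral lborel (\<lambda>s. (1 - exp (- s * (norm z)\<^sup>2)) * k s) (C * norm z powr \<alpha>)" for z :: 'b
    using k[of "(norm z)\<^sup>2"] by (simp add: powr2)
  show ?thesis
  \<comment> \<open>Keeping only s in \<open>{1/2..1}\<close> costs the length 1/2 and the square of
    the factor 1/2 from \<open>exp_chord_le\<close>, hence 1/8; on that interval \<open>k\<close> is
    at least 1. Division by \<open>C\<close> undoes the constant of the subordination
    formula.\<close>
  proof (intro exI[of _ "1 / (8 * C)"] conjI allI impI)
    fix I :: "'i set" and w :: "'i \<Rightarrow> real" and x :: "'i \<Rightarrow> 'b"
    assume I: "finite I" "\<forall>i\<in>I. 0 \<le> w i" "sum w I = 1"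
    define H where "H = (\<Sum>i\<in>I. w i * (1 - exp (- (norm (x i))\<^sup>2)))"
    define e where "e s i = exp (- s * (norm (x i))\<^sup>2)" for s i
    define F where "F s = 2 * (\<Sum>i\<in>I. w i * ((1 - e s i) * k s))
       - (\<Sum>i\<in>I. \<Sum>j\<in>I. w i * w j * ((1 - exp (- s * (norm (x i - x j))\<^sup>2)) * k s))" for s
    have F: "has_bochner_integral lborel F (2 * (\<Sum>i\<in>I. w i * (C * norm (x i) powr \<alpha>))
        - (\<Sum>i\<in>I. \<Sum>j\<in>I. w i * w j * (C * norm (x i - x j) powr \<alpha>)))"
      unfolding F_def e_def
      by (intro has_bochner_integral_diff has_bochner_integral_sum has_bochner_integral_mult_right k')
    have "emeasure lborel {1/2..1::real} < \<infinity>"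
      by (intro emeasure_compact_finite) auto
    then have "has_bochner_integral lborel (\<lambda>s. H\<^sup>2 / 4 * indicator {1/2..1::real} s) (H\<^sup>2 / 4 * (1 / 2))"
      using has_bochner_integral_real_indicator[of "{1/2..1::real}" lborel]
      by (intro has_bochner_integral_mult_right) auto
    moreover have "H\<^sup>2 / 4 * indicator {1/2..1} s \<le> F s" for s
    proof -
      have w2: "(\<Sum>i\<in>I. \<Sum>j\<in>I. w i * w j) = 1"
        using I by (simp flip: sum_product)
      have sum_e: "(\<Sum>i\<in>I. w i * (1 - e s i)) = 1 - (\<Sum>i\<in>I. w i * e s i)"
        using I by (simp add: right_diff_distrib sum_subtractf)
      have F_eq: "F s = (2 * (1 - (\<Sum>i\<in>I. w i * e s i))
          - (1 - (\<Sum>i\<in>I. \<Sum>j\<in>I. w i * w j * exp (- s * (norm (x i - x j))\<^sup>2)))) * k s"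
        unfolding F_def sum_e[symmetric]
        by (subst w2[symmetric]) (simp add: sum_distrib_right sum_distrib_left sum_subtractf algebra_simps)
      \<comment> \<open>With S the sum of \<open>w i * e s i\<close>, the kernel bound puts S^2
        below the double sum, and 2 (1 - S) - (1 - S^2) = (1 - S)^2.\<close>
      have F_ge: "(1 - (\<Sum>i\<in>I. w i * e s i))\<^sup>2 * k s \<le> F s" if "0 \<le> s"
      proof -
        have "(\<Sum>i\<in>I. w i * e s i)\<^sup>2 \<le> (\<Sum>i\<in>I. \<Sum>j\<in>I. w i * w j * exp (- s * (norm (x i - x j))\<^sup>2))"
          unfolding e_def by (rule gaussian_kernel_ge[OF I(1) that])
        then show ?thesis
          unfolding F_eq by (intro mult_right_mono) (auto simp: k_def power2_eq_square algebra_simps)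
      qed
      consider "s < 0" | "0 \<le> s" "s \<notin> {1/2..1}" | "s \<in> {1/2..1}" by force
      then show ?thesis
      proof cases
        case 1
        then show ?thesis by (simp add: F_def k_def)
      next
        case 2
        have "0 \<le> (1 - (\<Sum>i\<in>I. w i * e s i))\<^sup>2 * k s" by (simp add: k_def)
        with F_ge 2 show ?thesis by simp
      next
        case 3
        have "H * (1 / 2) \<le> H * s"
          using 3 I unfolding H_def by (intro mult_left_mono sum_nonneg) auto
        also have "\<dots> \<le> (\<Sum>i\<in>I. w i * (1 - e s i))"
          unfolding H_def sum_distrib_right e_def
        proof (intro sum_mono)
          fix i assume "i \<in> I"
          then have "w i * (s * (1 - exp (- (norm (x i))\<^sup>2))) \<le> w i * (1 - exp (- s * (norm (x i))\<^sup>2))"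
            using 3 I(2) by (intro mult_left_mono exp_chord_le) auto
          then show "w i * (1 - exp (- (norm (x i))\<^sup>2)) * s \<le> w i * (1 - exp (- s * (norm (x i))\<^sup>2))"
            by (simp add: mult_ac)
        qed
        finally have "H * (1 / 2) \<le> 1 - (\<Sum>i\<in>I. w i * e s i)"
          unfolding sum_e .
        moreover have "0 \<le> H"
          using I unfolding H_def by (intro sum_nonneg) auto
        ultimately have "(H * (1 / 2))\<^sup>2 \<le> (1 - (\<Sum>i\<in>I. w i * e s i))\<^sup>2"
          by (intro power_mono) auto
        moreover have "k s \<ge> 1"
        proof -
          have "s powr 0 \<le> s powr (- 1 - \<alpha> / 2)"
            using 3 assms by (intro powr_mono') auto
          then show ?thesis using 3 by (simp add: k_def)
        qed
        ultimately have "(H * (1 / 2))\<^sup>2 * 1 \<le> (1 - (\<Sum>i\<in>I. w i * e s i))\<^sup>2 * k s"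
          by (intro mult_mono) auto
        also have "\<dots> \<le> F s" using F_ge 3 by simp
        finally show ?thesis using 3 by (simp add: power_divide)
      qed
    qed
    ultimately have "H\<^sup>2 / 4 * (1 / 2) \<le> 2 * (\<Sum>i\<in>I. w i * (C * norm (x i) powr \<alpha>))
        - (\<Sum>i\<in>I. \<Sum>j\<in>I. w i * w j * (C * norm (x i - x j) powr \<alpha>))"
      using F integral_mono[of lborel "\<lambda>s. H\<^sup>2 / 4 * indicator {1/2..1} s" F]
      by (simp add: has_bochner_integral_iff)
    also have "\<dots> = C * (2 * (\<Sum>i\<in>I. w i * norm (x i) powr \<alpha>)
        - (\<Sum>i\<in>I. \<Sum>j\<in>I. w i * w j * norm (x i - x j) powr \<alpha>))"
      by (simp add: right_diff_distrib sum_distrib_left mult_ac)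
    finally have "H\<^sup>2 / 8 \<le> C * (2 * (\<Sum>i\<in>I. w i * norm (x i) powr \<alpha>)
        - (\<Sum>i\<in>I. \<Sum>j\<in>I. w i * w j * norm (x i - x j) powr \<alpha>))" by simp
    then have "H\<^sup>2 / 8 / C \<le> 2 * (\<Sum>i\<in>I. w i * norm (x i) powr \<alpha>)
        - (\<Sum>i\<in>I. \<Sum>j\<in>I. w i * w j * norm (x i - x j) powr \<alpha>)"
      using C by (simp add: pos_divide_le_eq mult.commute)
    then show "(\<Sum>i\<in>I. \<Sum>j\<in>I. w i * w j * norm (x i - x j) powr \<alpha>)
      \<le> 2 * (\<Sum>i\<in>I. w i * norm (x i) powr \<alpha>) - 1 / (8 * C) * (\<Sum>i\<in>I. w i * (1 - exp (- (norm (x i))\<^sup>2)))\<^sup>2"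
      by (simp add: H_def)
  qed (use C in simp)
qed

section \<open>Invariant weights and the uniform gap\<close>

definition convex_weights :: "real set \<Rightarrow> real set \<Rightarrow> (real \<Rightarrow> real) \<Rightarrow> bool" where
  "convex_weights T K w \<longleftrightarrow> finite K \<and> K \<subseteq> T \<and> (\<forall>i\<in>K. 0 \<le> w i) \<and> sum w K = 1"

text \<open>For small r the left side is at most r^2, and the exponent is at most 2; for large r it
  is below 1. This makes \<open>h (f t)\<close> integrable.\<close>

lemma one_minus_exp_le_powr:
  fixes r :: real
  assumes "0 < \<alpha>" "\<alpha> \<le> 2" "0 \<le> r"
  shows "1 - exp (- r\<^sup>2) \<le> r powr \<alpha>"
proof (cases "r \<le> 1")
  case True
  have "1 - exp (- r\<^sup>2) \<le> r\<^sup>2" using exp_ge_add_one_self[of "- r\<^sup>2"] by simp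
  also have "r\<^sup>2 \<le> r powr \<alpha>"
  proof (cases "r = 0")
    case False
    then have "r powr 2 \<le> r powr \<alpha>" using True assms by (intro powr_mono') auto
    then show ?thesis using False assms by simp
  qed simp
  finally show ?thesis .
next
  case False
  then have "1 powr \<alpha> \<le> r powr \<alpha>" using assms by (intro powr_mono2) auto
  then have "1 \<le> r powr \<alpha>" by simp
  then show ?thesis using exp_gt_zero[of "- r\<^sup>2"] by linarith
qed

text \<open>Two points of weight 1/2 in the conditional negativity estimate. Its use is
  integrability of increments of the kernel.\<close>

lemma norm_diff_powr_le:
  fixes x y :: "'b::euclidean_space"
  assumes "0 < \<alpha>" "\<alpha> < 2"
  shows "norm (x - y) powr \<alpha> \<le> 2 * (norm x powr \<alpha> + norm y powr \<alpha>)"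
proof -
  obtain \<kappa> :: real where "\<kappa> > 0" and
    \<kappa>: "\<forall>I w (z :: bool \<Rightarrow> 'b). finite I \<longrightarrow> (\<forall>i\<in>I. 0 \<le> w i) \<longrightarrow> sum w I = 1 \<longrightarrow>
      (\<Sum>i\<in>I. \<Sum>j\<in>I. w i * w j * norm (z i - z j) powr \<alpha>)
      \<le> 2 * (\<Sum>i\<in>I. w i * norm (z i) powr \<alpha>) - \<kappa> * (\<Sum>i\<in>I. w i * (1 - exp (- (norm (z i))\<^sup>2)))\<^sup>2"
    using norm_powr_conditionally_negative[OF assms, where 'i=bool and 'b='b] by (elim exE conjE that)
  have "(\<Sum>i\<in>UNIV. \<Sum>j\<in>UNIV. 1 / 2 * (1 / 2) * norm ((if i then x else y) - (if j then x else y)) powr \<alpha>)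
      \<le> 2 * (\<Sum>i\<in>UNIV. 1 / 2 * norm (if i then x else y) powr \<alpha>) -
        \<kappa> * (\<Sum>i\<in>UNIV. 1 / 2 * (1 - exp (- (norm (if i then x else y))\<^sup>2)))\<^sup>2"
    by (rule \<kappa>[rule_format]) (simp_all add: UNIV_bool)
  also have "\<dots> \<le> 2 * (\<Sum>i\<in>UNIV. 1 / 2 * norm (if i then x else y) powr \<alpha>)"
    using \<open>\<kappa> > 0\<close> by simp
  finally show ?thesis
    by (simp add: UNIV_bool norm_minus_commute)
qed

text \<open>The test function for Cauchy-Schwarz. Square integrability permits an infinite
  \<open>\<nu>\<close>; strict positivity ensures that a vanishing weighted integral forces
  \<open>f t\<close> to vanish almost everywhere. The invariance is stated with the nonnegative
  integral, so that it makes sense before integrability is known.\<close>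

definition invariant_weight :: "real set \<Rightarrow> 's measure \<Rightarrow> (real \<Rightarrow> 's \<Rightarrow> 'b::real_normed_vector) \<Rightarrow> bool" where
  "invariant_weight T \<nu> f \<longleftrightarrow>
     (\<exists>\<psi> A. \<psi> \<in> borel_measurable \<nu> \<and> (\<forall>s\<in>space \<nu>. 0 < \<psi> s) \<and> integrable \<nu> (\<lambda>s. (\<psi> s)\<^sup>2) \<and>
        (\<forall>t\<in>T. (\<integral>\<^sup>+s. ennreal (\<psi> s * (1 - exp (- (norm (f t s))\<^sup>2))) \<partial>\<nu>) = A))"

text \<open>The pointwise estimate is integrated. With H the average of \<open>h (f i)\<close>,
  Cauchy-Schwarz bounds the integral of H^2 below by A^2 / B, where A is the invariant weighted
  integral and B the integral of the squared weight; neither depends on the weights or the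
  times.\<close>

lemma uniform_gap:
  fixes f :: "real \<Rightarrow> 's \<Rightarrow> 'b::euclidean_space"
  assumes \<alpha>: "0 < \<alpha>" "\<alpha> < 2"
    and L: "\<And>t. t \<in> T \<Longrightarrow> in_L \<alpha> \<nu> (f t)"
    and c: "\<And>t. t \<in> T \<Longrightarrow> (\<integral>s. norm (f t s) powr \<alpha> \<partial>\<nu>) = c"
    and inv: "invariant_weight T \<nu> f"
    and t0: "t0 \<in> T"
  shows "\<exists>\<delta>\<ge>0. (c \<noteq> 0 \<longrightarrow> 0 < \<delta>) \<and>
    (\<forall>K w. convex_weights T K w \<longrightarrow>
      (\<Sum>i\<in>K. \<Sum>j\<in>K. w i * w j * (\<integral>s. norm (f i s - f j s) powr \<alpha> \<partial>\<nu>)) \<le> 2 * c - \<delta>)"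
proof -
  obtain \<psi> A0 where \<psi>[measurable]: "\<psi> \<in> borel_measurable \<nu>" and \<psi>_pos: "\<And>s. s \<in> space \<nu> \<Longrightarrow> 0 < \<psi> s"
    and \<psi>2: "integrable \<nu> (\<lambda>s. (\<psi> s)\<^sup>2)"
    and inv: "\<And>t. t \<in> T \<Longrightarrow> (\<integral>\<^sup>+s. ennreal (\<psi> s * (1 - exp (- (norm (f t s))\<^sup>2))) \<partial>\<nu>) = A0"
    using inv unfolding invariant_weight_def by blast
  define h where "h z = 1 - exp (- (norm z)\<^sup>2)" for z :: 'b
  have h: "0 \<le> h z" "h z \<le> 1" "h z \<le> norm z powr \<alpha>" for z
    using one_minus_exp_le_powr[of \<alpha> "norm z"] \<alpha> by (auto simp: h_def)
  have [measurable]: "h \<in> borel_measurable borel" unfolding h_def by measurable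
  have [measurable]: "f t \<in> borel_measurable \<nu>" if "t \<in> T" for t
    using L[OF that] by (simp add: in_L_def)
  have int: "integrable \<nu> (\<lambda>s. norm (f t s) powr \<alpha>)" if "t \<in> T" for t
    using L[OF that] by (simp add: in_L_def)
  have int_diff: "integrable \<nu> (\<lambda>s. norm (f t s - f u s) powr \<alpha>)" if "t \<in> T" "u \<in> T" for t u
  proof (rule Bochner_Integration.integrable_bound)
    show "integrable \<nu> (\<lambda>s. 2 * (norm (f t s) powr \<alpha> + norm (f u s) powr \<alpha>))"
      using int that by auto
    show "AE s in \<nu>. norm (norm (f t s - f u s) powr \<alpha>) \<le> norm (2 * (norm (f t s) powr \<alpha> + norm (f u s) powr \<alpha>))"
      using norm_diff_powr_le[OF \<alpha>] by (auto simp: abs_mult)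
  qed (use that in measurable)
  have int_\<psi>h: "integrable \<nu> (\<lambda>s. \<psi> s * h (f t s))" if "t \<in> T" for t
  proof (rule Bochner_Integration.integrable_bound)
    show "integrable \<nu> (\<lambda>s. (\<psi> s)\<^sup>2 + norm (f t s) powr \<alpha>)"
      using \<psi>2 int that by auto
    have "\<bar>p * h z\<bar> \<le> p\<^sup>2 + norm z powr \<alpha>" for p z
    proof -
      have "\<bar>p * h z\<bar> \<le> p\<^sup>2 + (h z)\<^sup>2"
        using sum_squares_bound[of "\<bar>p\<bar>" "\<bar>h z\<bar>"] abs_ge_zero[of "p * h z"]
        unfolding abs_mult power2_abs by linarith
      also have "(h z)\<^sup>2 \<le> h z" using h[of z] by (simp add: power2_eq_square mult_left_le)
      finally show ?thesis using h[of z] by linarith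
    qed
    then show "AE s in \<nu>. norm (\<psi> s * h (f t s)) \<le> norm ((\<psi> s)\<^sup>2 + norm (f t s) powr \<alpha>)"
      by auto
  qed (use that in measurable)
  define A where "A = (\<integral>s. \<psi> s * h (f t0 s) \<partial>\<nu>)"
  define B where "B = (\<integral>s. (\<psi> s)\<^sup>2 \<partial>\<nu>)"
  have \<psi>h_nonneg: "AE s in \<nu>. 0 \<le> \<psi> s * h (f t s)" for t
    using \<psi>_pos h by (intro AE_I2 mult_nonneg_nonneg) (auto intro: less_imp_le)
  have A: "(\<integral>s. \<psi> s * h (f t s) \<partial>\<nu>) = A" if "t \<in> T" for t
  proof -
    have "(\<integral>s. \<psi> s * h (f t s) \<partial>\<nu>) = enn2real A0" if "t \<in> T" for t
      using inv[OF that] that \<psi>h_nonneg by (subst integral_eq_nn_integral) (auto simp: h_def)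
    with that t0 show ?thesis by (simp add: A_def)
  qed
  have "A \<ge> 0" unfolding A_def using \<psi>h_nonneg by (rule integral_nonneg_AE)
  have "B \<ge> 0" unfolding B_def by simp
  obtain \<kappa> :: real where "\<kappa> > 0" and
    \<kappa>: "\<forall>I w (x :: real \<Rightarrow> 'b). finite I \<longrightarrow> (\<forall>i\<in>I. 0 \<le> w i) \<longrightarrow> sum w I = 1 \<longrightarrow>
      (\<Sum>i\<in>I. \<Sum>j\<in>I. w i * w j * norm (x i - x j) powr \<alpha>)
      \<le> 2 * (\<Sum>i\<in>I. w i * norm (x i) powr \<alpha>) - \<kappa> * (\<Sum>i\<in>I. w i * h (x i))\<^sup>2"
    using norm_powr_conditionally_negative[OF \<alpha>, where 'i=real and 'b='b, folded h_def]
    by (elim exE conjE that)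
  show ?thesis
  proof (intro exI[of _ "\<kappa> * (A\<^sup>2 / (B + 1))"] conjI allI impI)
    show "0 \<le> \<kappa> * (A\<^sup>2 / (B + 1))"
      using \<open>\<kappa> > 0\<close> \<open>B \<ge> 0\<close> by simp
    show "0 < \<kappa> * (A\<^sup>2 / (B + 1))" if "c \<noteq> 0"
    proof -
      \<comment> \<open>\<open>h\<close> vanishes only at 0 and \<open>\<psi>\<close> is positive,
        so A = 0 would make \<open>f t0\<close> zero almost everywhere, against
        \<open>c \<noteq> 0\<close>.\<close>
      have "A \<noteq> 0"
      proof
        assume "A = 0"
        then have "AE s in \<nu>. \<psi> s * h (f t0 s) = 0"
          using integral_nonneg_eq_0_iff_AE[OF int_\<psi>h[OF t0] \<psi>h_nonneg] by (simp add: A_def)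
        then have "AE s in \<nu>. norm (f t0 s) powr \<alpha> = 0"
        proof (rule AE_mp, intro AE_I2 impI)
          fix s assume "s \<in> space \<nu>" "\<psi> s * h (f t0 s) = 0"
          then show "norm (f t0 s) powr \<alpha> = 0" using \<psi>_pos[of s] by (auto simp: h_def)
        qed
        then have "(\<integral>s. norm (f t0 s) powr \<alpha> \<partial>\<nu>) = 0"
          by (rule integral_eq_zero_AE)
        with c[OF t0] that show False by simp
      qed
      then show ?thesis using \<open>\<kappa> > 0\<close> \<open>B \<ge> 0\<close> by simp
    qed
    fix K and w :: "real \<Rightarrow> real"
    assume "convex_weights T K w"
    then have K: "finite K" "K \<subseteq> T" "\<forall>i\<in>K. 0 \<le> w i" "sum w K = 1"
      by (auto simp: convex_weights_def)
    \<comment> \<open>Close to the maximiser A / B of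
      \<open>2 * \<epsilon> * A - \<epsilon>\<^sup>2 * B\<close>; the summand 1 covers B = 0 and
      still leaves at least \<open>\<epsilon> * A\<close>.\<close>
    define \<epsilon> where "\<epsilon> = A / (B + 1)"
    \<comment> \<open>Cauchy-Schwarz in linearised form: expanding the square of
      \<open>H - \<epsilon> * \<psi>\<close> bounds H^2 below by terms whose integrals are A and
      B.\<close>
    have pw: "(\<Sum>i\<in>K. \<Sum>j\<in>K. w i * w j * norm (f i s - f j s) powr \<alpha>)
       \<le> 2 * (\<Sum>i\<in>K. w i * norm (f i s) powr \<alpha>)
          - \<kappa> * (2 * \<epsilon> * (\<Sum>i\<in>K. w i * (\<psi> s * h (f i s))) - \<epsilon>\<^sup>2 * (\<psi> s)\<^sup>2)" for s
    proof -
      let ?H = "\<Sum>i\<in>K. w i * h (f i s)"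
      have "(\<Sum>i\<in>K. w i * (\<psi> s * h (f i s))) = \<psi> s * ?H"
        by (simp add: sum_distrib_left mult_ac)
      moreover have "2 * \<epsilon> * (\<psi> s * ?H) - \<epsilon>\<^sup>2 * (\<psi> s)\<^sup>2 \<le> ?H\<^sup>2"
        using zero_le_power2[of "?H - \<epsilon> * \<psi> s"] by (simp add: power2_diff power_mult_distrib mult_ac)
      ultimately have "\<kappa> * (2 * \<epsilon> * (\<Sum>i\<in>K. w i * (\<psi> s * h (f i s))) - \<epsilon>\<^sup>2 * (\<psi> s)\<^sup>2) \<le> \<kappa> * ?H\<^sup>2"
        using \<open>\<kappa> > 0\<close> by (intro mult_left_mono) auto
      with \<kappa>[THEN spec, THEN spec, THEN spec, THEN mp, THEN mp, THEN mp, OF K(1,3,4), of "\<lambda>i. f i s"] show ?thesis by linarith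
    qed
    have KT: "i \<in> T" if "i \<in> K" for i using K that by auto
    have "(\<Sum>i\<in>K. \<Sum>j\<in>K. w i * w j * (\<integral>s. norm (f i s - f j s) powr \<alpha> \<partial>\<nu>))
        = (\<integral>s. (\<Sum>i\<in>K. \<Sum>j\<in>K. w i * w j * norm (f i s - f j s) powr \<alpha>) \<partial>\<nu>)"
      using int_diff KT by (simp add: Bochner_Integration.integral_sum)
    also have "\<dots> \<le> (\<integral>s. 2 * (\<Sum>i\<in>K. w i * norm (f i s) powr \<alpha>)
          - \<kappa> * (2 * \<epsilon> * (\<Sum>i\<in>K. w i * (\<psi> s * h (f i s))) - \<epsilon>\<^sup>2 * (\<psi> s)\<^sup>2) \<partial>\<nu>)"
      using pw int int_diff KT int_\<psi>h \<psi>2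
      by (intro integral_mono) auto
    also have "\<dots> = 2 * (\<Sum>i\<in>K. w i * c) - \<kappa> * (2 * \<epsilon> * (\<Sum>i\<in>K. w i * A) - \<epsilon>\<^sup>2 * B)"
      using int KT int_\<psi>h \<psi>2 c A by (simp add: B_def cong: sum.cong)
    also have "\<dots> = 2 * c - \<kappa> * (2 * \<epsilon> * A - \<epsilon>\<^sup>2 * B)"
      using K(4) by (simp flip: sum_distrib_right)
    also have "\<dots> \<le> 2 * c - \<kappa> * (A\<^sup>2 / (B + 1))"
    proof -
      have "\<epsilon> * B \<le> A" using \<open>A \<ge> 0\<close> \<open>B \<ge> 0\<close> by (simp add: \<epsilon>_def divide_simps algebra_simps)
      moreover have "0 \<le> \<epsilon>" using \<open>A \<ge> 0\<close> \<open>B \<ge> 0\<close> by (simp add: \<epsilon>_def)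
      ultimately have "\<epsilon> * (\<epsilon> * B) \<le> \<epsilon> * A" by (intro mult_left_mono)
      then have "\<epsilon> * A \<le> 2 * \<epsilon> * A - \<epsilon>\<^sup>2 * B" by (simp add: power2_eq_square mult_ac)
      moreover have "\<epsilon> * A = A\<^sup>2 / (B + 1)" by (simp add: \<epsilon>_def power2_eq_square)
      ultimately have "\<kappa> * (A\<^sup>2 / (B + 1)) \<le> \<kappa> * (2 * \<epsilon> * A - \<epsilon>\<^sup>2 * B)"
        using \<open>\<kappa> > 0\<close> by (intro mult_left_mono) auto
      then show ?thesis by linarith
    qed
    finally show "(\<Sum>i\<in>K. \<Sum>j\<in>K. w i * w j * (\<integral>s. norm (f i s - f j s) powr \<alpha> \<partial>\<nu>))
        \<le> 2 * c - \<kappa> * (A\<^sup>2 / (B + 1))" .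
  qed
qed

section \<open>Invariant limits of convex combinations\<close>

text \<open>By monotone convergence the sum has finite integral, so it is finite almost everywhere.
  It turns fast convergence in \<open>L\<^sup>2\<close> into pointwise convergence.\<close>

lemma AE_summable_if_integrals_summable:
  fixes f :: "nat \<Rightarrow> 'w \<Rightarrow> real"
  assumes f: "\<And>n. integrable M (f n)" "\<And>n x. 0 \<le> f n x"
    and b: "\<And>n. (\<integral>x. f n x \<partial>M) \<le> b n" "summable b"
  shows "AE x in M. summable (\<lambda>n. f n x)"
proof -
  have [measurable]: "f n \<in> borel_measurable M" for n using f by auto
  have b_nonneg: "0 \<le> b n" for n
    using Bochner_Integration.integral_nonneg[of M "f n"] f b(1)[of n] by (meson order_trans)
  have "(\<integral>\<^sup>+x. (\<Sum>n. ennreal (f n x)) \<partial>M) = (\<Sum>n. \<integral>\<^sup>+x. ennreal (f n x) \<partial>M)"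
    by (rule nn_integral_suminf) auto
  also have "\<dots> \<le> (\<Sum>n. ennreal (b n))"
    using f b(1) by (intro suminf_le) (auto simp: nn_integral_eq_integral intro!: ennreal_leI)
  also have "\<dots> = ennreal (suminf b)"
    using b_nonneg b(2) by (intro suminf_ennreal2) auto
  finally have "(\<integral>\<^sup>+x. (\<Sum>n. ennreal (f n x)) \<partial>M) \<noteq> \<infinity>"
    by (auto simp: top_unique)
  then have "AE x in M. (\<Sum>n. ennreal (f n x)) \<noteq> \<infinity>"
    by (intro nn_integral_PInf_AE) auto
  then show ?thesis
    by (rule AE_mp) (auto intro!: summable_suminf_not_top f)
qed

lemma space_PiM_borel_sample_path [simp]: "sample_path T X \<omega> \<in> space (\<Pi>\<^sub>M t\<in>T. borel)"
  by (simp add: sample_path_def space_PiM)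

lemma measurable_sample_path:
  assumes "\<And>t. t \<in> T \<Longrightarrow> X t \<in> borel_measurable P"
  shows "sample_path T X \<in> measurable P (\<Pi>\<^sub>M t\<in>T. borel)"
  unfolding sample_path_def using assms by (intro measurable_restrict) auto

text \<open>One event suffices: being at most the mean m is invariant, so it has probability 0 or 1.
  Then \<open>Y - m\<close> has a fixed sign and mean 0, hence is 0.\<close>

lemma ergodic_invariant_const_real:
  fixes G :: "(real \<Rightarrow> 'a::topological_space) \<Rightarrow> real" and X :: "real \<Rightarrow> 'w \<Rightarrow> 'a"
  assumes "prob_space P" and erg: "ergodic T P X"
    and X: "\<And>t. t \<in> T \<Longrightarrow> X t \<in> borel_measurable P"
    and G[measurable]: "G \<in> borel_measurable (\<Pi>\<^sub>M t\<in>T. borel)"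
    and int: "integrable P (\<lambda>\<omega>. G (sample_path T X \<omega>))"
    and inv: "\<And>h. h \<in> T \<Longrightarrow> AE \<omega> in P. G (sample_path T (\<lambda>t. X (t + h)) \<omega>) = G (sample_path T X \<omega>)"
  shows "\<exists>m. AE \<omega> in P. G (sample_path T X \<omega>) = m"
proof -
  interpret prob_space P by fact
  define Y where "Y \<omega> = G (sample_path T X \<omega>)" for \<omega>
  define m where "m = (\<integral>\<omega>. Y \<omega> \<partial>P)"
  have [measurable]: "Y \<in> borel_measurable P" using int unfolding Y_def by simp
  have int: "integrable P Y" using int unfolding Y_def .
  define A where "A = {x \<in> space (\<Pi>\<^sub>M t\<in>T. borel). G x \<le> m}"
  have mem: "sample_path T Z \<omega> \<in> A \<longleftrightarrow> G (sample_path T Z \<omega>) \<le> m"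
    for Z :: "real \<Rightarrow> 'w \<Rightarrow> 'a" and \<omega>
    by (simp add: A_def)
  have "A \<in> sets (\<Pi>\<^sub>M t\<in>T. borel)" unfolding A_def by measurable
  moreover have "AE \<omega> in P. sample_path T (\<lambda>t. X (t + h)) \<omega> \<in> A \<longleftrightarrow> sample_path T X \<omega> \<in> A" if "h \<in> T" for h
    using inv[OF that] by (rule AE_mp) (auto simp: mem)
  ultimately have "measure P {\<omega> \<in> space P. sample_path T X \<omega> \<in> A} \<in> {0, 1}"
    using erg unfolding ergodic_def by blast
  then consider "prob {\<omega> \<in> space P. Y \<omega> \<le> m} = 0" | "prob {\<omega> \<in> space P. Y \<omega> \<le> m} = 1"
    by (auto simp: mem Y_def)
  then have "AE \<omega> in P. Y \<omega> = m"
  proof cases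
    case 1
    then have "AE \<omega> in P. \<not> Y \<omega> \<le> m"
      by (subst (asm) prob_eq_0) auto
    then have nn: "AE \<omega> in P. 0 \<le> Y \<omega> - m" by (rule AE_mp) auto
    have "(\<integral>\<omega>. Y \<omega> - m \<partial>P) = 0" using int by (simp add: m_def prob_space)
    then have "AE \<omega> in P. Y \<omega> - m = 0"
      using integral_nonneg_eq_0_iff_AE[OF _ nn] int by simp
    then show ?thesis by (rule AE_mp) auto
  next
    case 2
    then have "AE \<omega> in P. Y \<omega> \<le> m"
      by (subst (asm) prob_eq_1) auto
    then have nn: "AE \<omega> in P. 0 \<le> m - Y \<omega>" by (rule AE_mp) auto
    have "(\<integral>\<omega>. m - Y \<omega> \<partial>P) = 0" using int by (simp add: m_def prob_space)
    then have "AE \<omega> in P. m - Y \<omega> = 0"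
      using integral_nonneg_eq_0_iff_AE[OF _ nn] int by simp
    then show ?thesis by (rule AE_mp) auto
  qed
  then show ?thesis unfolding Y_def by blast
qed

lemma ergodic_invariant_const_complex:
  fixes G :: "(real \<Rightarrow> 'a::topological_space) \<Rightarrow> complex"
  assumes "prob_space P" and "ergodic T P X"
    and "\<And>t. t \<in> T \<Longrightarrow> X t \<in> borel_measurable P"
    and [measurable]: "G \<in> borel_measurable (\<Pi>\<^sub>M t\<in>T. borel)"
    and "integrable P (\<lambda>\<omega>. G (sample_path T X \<omega>))"
    and inv: "\<And>h. h \<in> T \<Longrightarrow> AE \<omega> in P. G (sample_path T (\<lambda>t. X (t + h)) \<omega>) = G (sample_path T X \<omega>)"
  shows "\<exists>\<kappa>. AE \<omega> in P. G (sample_path T X \<omega>) = \<kappa>"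
proof -
  have "\<exists>a. AE \<omega> in P. Re (G (sample_path T X \<omega>)) = a"
    using assms(5) by (intro ergodic_invariant_const_real assms(1-3)) (auto intro: AE_mp[OF inv])
  moreover have "\<exists>b. AE \<omega> in P. Im (G (sample_path T X \<omega>)) = b"
    using assms(5) by (intro ergodic_invariant_const_real assms(1-3)) (auto intro: AE_mp[OF inv])
  ultimately obtain a b where "AE \<omega> in P. Re (G (sample_path T X \<omega>)) = a"
    "AE \<omega> in P. Im (G (sample_path T X \<omega>)) = b" by blast
  then have "AE \<omega> in P. G (sample_path T X \<omega>) = Complex a b"
    by eventually_elim (simp add: complex_eq_iff)
  then show ?thesis by blast
qed

lemma complex_parallelogram:
  "(cmod (a - b))\<^sup>2 = 2 * (cmod a)\<^sup>2 + 2 * (cmod b)\<^sup>2 - 4 * (cmod ((a + b) / 2))\<^sup>2"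
proof -
  have "(cmod (a - b))\<^sup>2 + (cmod (a + b))\<^sup>2 = 2 * (cmod a)\<^sup>2 + 2 * (cmod b)\<^sup>2"
    unfolding cmod_power2 by (simp add: power2_eq_square algebra_simps)
  then show ?thesis by (simp add: norm_divide power_divide)
qed

text \<open>Either the norm is below \<open>(1 / 2) ^ n\<close>, or \<open>2 ^ n\<close> times it is
  at least 1. Thus summability of the squares with weights \<open>2 ^ n\<close> gives absolute
  summability.\<close>

lemma norm_le_weighted_square:
  "norm z \<le> 2 ^ n * (norm z)\<^sup>2 + (1 / 2) ^ n"
proof (cases "norm z \<le> (1 / 2) ^ n")
  case False
  then have "1 \<le> 2 ^ n * norm z" by (simp add: field_simps)
  then have "1 * norm z \<le> 2 ^ n * norm z * norm z" by (intro mult_right_mono) auto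
  moreover have "0 \<le> (1 / 2 :: real) ^ n" by simp
  ultimately show ?thesis by (simp add: power2_eq_square mult_ac add_increasing2)
qed (simp add: add_increasing)

text \<open>
  The Alaoglu--Birkhoff form of the mean ergodic theorem: a sequence in \<open>H\<close> minimizing the
  \<open>L\<^sup>2\<close> norm converges to an invariant function. Unlike time averages, this needs no
  measurability in time when \<open>T = UNIV\<close>.
\<close>

lemma ergodic_minimizing_sequence:
  fixes X :: "real \<Rightarrow> 'w \<Rightarrow> 'a::topological_space" and H :: "((real \<Rightarrow> 'a) \<Rightarrow> complex) set"
    and P :: "'w measure" and T :: "real set"
  defines "sq \<equiv> \<lambda>(X :: real \<Rightarrow> 'w \<Rightarrow> 'a) F. \<integral>\<omega>. (cmod (F (sample_path T X \<omega>)))\<^sup>2 \<partial>P"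
  assumes P: "prob_space P" and erg: "ergodic T P X"
    and X: "\<And>t. t \<in> T \<Longrightarrow> X t \<in> borel_measurable P"
    and T: "\<And>s t. s \<in> T \<Longrightarrow> t \<in> T \<Longrightarrow> s + t \<in> T"
    and ne: "H \<noteq> {}"
    and H_meas: "\<And>F. F \<in> H \<Longrightarrow> F \<in> borel_measurable (\<Pi>\<^sub>M t\<in>T. borel)"
    and H_bdd: "\<And>F x. F \<in> H \<Longrightarrow> cmod (F x) \<le> 1"
    and H_mid: "\<And>F G. F \<in> H \<Longrightarrow> G \<in> H \<Longrightarrow> (\<lambda>x. (F x + G x) / 2) \<in> H"
    and H_shift: "\<And>F h. F \<in> H \<Longrightarrow> h \<in> T \<Longrightarrow> (\<lambda>x. F (\<lambda>t\<in>T. x (t + h))) \<in> H"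
    and sq_shift: "\<And>F h. F \<in> H \<Longrightarrow> h \<in> T \<Longrightarrow> sq (\<lambda>t. X (t + h)) F = sq X F"
  obtains F \<kappa> where "\<And>n. F n \<in> H"
    "(\<lambda>n. \<integral>\<omega>. F n (sample_path T X \<omega>) \<partial>P) \<longlonglongrightarrow> \<kappa>" "(\<lambda>n. sq X (F n)) \<longlonglongrightarrow> (cmod \<kappa>)\<^sup>2"
proof -
  interpret prob_space P by fact
  have Xh: "X (t + h) \<in> borel_measurable P" if "h \<in> T" "t \<in> T" for h t
    using X T that by auto
  have path[measurable]: "sample_path T X \<in> measurable P (\<Pi>\<^sub>M t\<in>T. borel)"
    using X by (rule measurable_sample_path)
  have path_shift: "sample_path T (\<lambda>t. X (t + h)) \<omega> = (\<lambda>t\<in>T. sample_path T X \<omega> (t + h))" if "h \<in> T" for h \<omega>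
    using T that by (auto simp: sample_path_def fun_eq_iff)
  define N where "N F = sq X F" for F
  define D where "D = Inf (N ` H)"
  have N_nonneg: "0 \<le> N F" for F by (simp add: N_def sq_def)
  have D_le: "D \<le> N F" if "F \<in> H" for F
    unfolding D_def by (rule cInf_lower) (use that N_nonneg in \<open>auto intro!: bdd_belowI[of _ 0]\<close>)
  have comp_meas: "(\<lambda>\<omega>. F (sample_path T X \<omega>)) \<in> borel_measurable P" if "F \<in> H" for F
    using H_meas[OF that] path by measurable
  have le1: "(cmod (F x))\<^sup>2 \<le> 1" if "F \<in> H" for F x
    using H_bdd[OF that] by (simp add: abs_square_le_1)
  have sq_int: "integrable P (\<lambda>\<omega>. (cmod (F (sample_path T X \<omega>)))\<^sup>2)" if "F \<in> H" for F
    using comp_meas[OF that] le1[OF that] by (intro integrable_const_bound[where B=1]) auto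
  \<comment> \<open>The midpoint stays in \<open>H\<close>, so its squared norm is at least
    \<open>D\<close>; the parallelogram identity then converts excess over \<open>D\<close> into a
    bound on the distance.\<close>
  have diff_sq: "integrable P (\<lambda>\<omega>. (cmod (F (sample_path T X \<omega>) - G (sample_path T X \<omega>)))\<^sup>2)"
    "(\<integral>\<omega>. (cmod (F (sample_path T X \<omega>) - G (sample_path T X \<omega>)))\<^sup>2 \<partial>P) \<le> 2 * (N F - D) + 2 * (N G - D)"
    if "F \<in> H" "G \<in> H" for F G
  proof -
    note ints = sq_int[OF that(1)] sq_int[OF that(2)] sq_int[OF H_mid[OF that]]
    show "integrable P (\<lambda>\<omega>. (cmod (F (sample_path T X \<omega>) - G (sample_path T X \<omega>)))\<^sup>2)"
      unfolding complex_parallelogram using ints by auto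
    have "(\<integral>\<omega>. (cmod (F (sample_path T X \<omega>) - G (sample_path T X \<omega>)))\<^sup>2 \<partial>P)
        = 2 * N F + 2 * N G - 4 * N (\<lambda>x. (F x + G x) / 2)"
      unfolding complex_parallelogram N_def sq_def using ints by simp
    then show "(\<integral>\<omega>. (cmod (F (sample_path T X \<omega>) - G (sample_path T X \<omega>)))\<^sup>2 \<partial>P) \<le> 2 * (N F - D) + 2 * (N G - D)"
      using D_le[OF H_mid[OF that]] by simp
  qed
  \<comment> \<open>The rate 1/4 beats the weights \<open>2 ^ n\<close> needed for absolute
    summability of the differences.\<close>
  have "\<exists>F\<in>H. N F < D + (1 / 4) ^ n" for n :: nat
    using cInf_lessD[of "N ` H" "D + (1 / 4) ^ n"] ne by (auto simp: D_def)
  then obtain F where F: "F n \<in> H" "N (F n) < D + (1 / 4) ^ n" for n :: nat by metis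
  \<comment> \<open>The limit is taken on path space, so that it can be evaluated at shifted paths.
    Where the sequence diverges \<open>lim\<close> is some default value; this happens on a null set
    only.\<close>
  define G where "G x = lim (\<lambda>n. F n x)" for x
  have [measurable]: "F n \<in> borel_measurable (\<Pi>\<^sub>M t\<in>T. borel)" for n using F H_meas by auto
  have [measurable]: "G \<in> borel_measurable (\<Pi>\<^sub>M t\<in>T. borel)"
    unfolding G_def by measurable
  \<comment> \<open>Stated for an arbitrary sequence with this rate, because it is applied both to
    \<open>F\<close> and to its shifts.\<close>
  have conv: "AE \<omega> in P. (\<lambda>n. K n (sample_path T X \<omega>)) \<longlonglongrightarrow> lim (\<lambda>n. K n (sample_path T X \<omega>))"
    if K: "\<And>n. K n \<in> H" "\<And>n. N (K n) < D + (1 / 4) ^ n" for K :: "nat \<Rightarrow> (real \<Rightarrow> 'a) \<Rightarrow> complex"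
  proof -
    define d where "d n \<omega> = K (Suc n) (sample_path T X \<omega>) - K n (sample_path T X \<omega>)" for n \<omega>
    have "AE \<omega> in P. summable (\<lambda>n. 2 ^ n * (cmod (d n \<omega>))\<^sup>2)"
    proof (rule AE_summable_if_integrals_summable)
      fix n
      show "integrable P (\<lambda>\<omega>. 2 ^ n * (cmod (d n \<omega>))\<^sup>2)"
        unfolding d_def using diff_sq(1)[OF K(1) K(1)] by auto
      have "(\<integral>\<omega>. (cmod (d n \<omega>))\<^sup>2 \<partial>P) \<le> 2 * (N (K (Suc n)) - D) + 2 * (N (K n) - D)"
        unfolding d_def by (rule diff_sq(2)[OF K(1) K(1)])
      also have "\<dots> \<le> 2 * (1 / 4) ^ Suc n + 2 * (1 / 4) ^ n"
        using K(2)[of n] K(2)[of "Suc n"] by simp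
      also have "\<dots> \<le> 4 * (1 / 4) ^ n" by simp
      finally have "2 ^ n * (\<integral>\<omega>. (cmod (d n \<omega>))\<^sup>2 \<partial>P) \<le> 2 ^ n * (4 * (1 / 4) ^ n)"
        by (intro mult_left_mono) auto
      also have "\<dots> = 4 * (1 / 2) ^ n"
        by (simp add: power_divide flip: power_mult_distrib)
          (simp add: field_simps flip: power_mult_distrib)
      finally show "(\<integral>\<omega>. 2 ^ n * (cmod (d n \<omega>))\<^sup>2 \<partial>P) \<le> 4 * (1 / 2) ^ n" by simp
    qed (auto intro!: summable_mult summable_geometric)
    then show ?thesis
    proof (rule AE_mp, intro AE_I2 impI)
      fix \<omega> assume "summable (\<lambda>n. 2 ^ n * (cmod (d n \<omega>))\<^sup>2)"
      then have "summable (\<lambda>n. 2 ^ n * (cmod (d n \<omega>))\<^sup>2 + (1 / 2) ^ n)"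
        by (intro summable_add summable_geometric) auto
      then have "summable (\<lambda>n. d n \<omega>)"
        using norm_le_weighted_square[of "d _ \<omega>"] by (intro summable_comparison_test[of "\<lambda>n. d n \<omega>"]) auto
      then have "(\<lambda>n. \<Sum>i<n. d i \<omega>) \<longlonglongrightarrow> (\<Sum>n. d n \<omega>)"
        by (rule summable_LIMSEQ)
      then have "(\<lambda>n. (\<Sum>i<n. d i \<omega>) + K 0 (sample_path T X \<omega>)) \<longlonglongrightarrow> (\<Sum>n. d n \<omega>) + K 0 (sample_path T X \<omega>)"
        by (intro tendsto_intros)
      also have "(\<lambda>n. (\<Sum>i<n. d i \<omega>) + K 0 (sample_path T X \<omega>)) = (\<lambda>n. K n (sample_path T X \<omega>))"
        unfolding d_def by (subst sum_lessThan_telescope) simp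
      finally show "(\<lambda>n. K n (sample_path T X \<omega>)) \<longlonglongrightarrow> lim (\<lambda>n. K n (sample_path T X \<omega>))"
        by (auto simp: convergent_LIMSEQ_iff[symmetric] convergent_def)
    qed
  qed
  have limG: "AE \<omega> in P. (\<lambda>n. F n (sample_path T X \<omega>)) \<longlonglongrightarrow> G (sample_path T X \<omega>)"
    unfolding G_def using F by (rule conv)
  have G_inv: "AE \<omega> in P. G (sample_path T (\<lambda>t. X (t + h)) \<omega>) = G (sample_path T X \<omega>)" if h: "h \<in> T" for h
  proof -
    \<comment> \<open>The shifted functionals lie in \<open>H\<close> and have the same norms, so
      they also minimise. By \<open>diff_sq\<close> two minimising sequences have the same limit,
      which is the invariance of \<open>G\<close>.\<close>
    define K where "K n = (\<lambda>x. F n (\<lambda>t\<in>T. x (t + h)))" for n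
    have K: "K n \<in> H" for n unfolding K_def using F(1) h by (rule H_shift)
    have K_path: "K n (sample_path T X \<omega>) = F n (sample_path T (\<lambda>t. X (t + h)) \<omega>)" for n \<omega>
      by (simp add: K_def path_shift[OF h])
    have "N (K n) = N (F n)" for n
      using sq_shift[OF F(1) h] by (simp add: N_def sq_def K_path)
    with F have NK: "N (K n) < D + (1 / 4) ^ n" for n by simp
    have 1: "AE \<omega> in P. (\<lambda>n. K n (sample_path T X \<omega>)) \<longlonglongrightarrow> lim (\<lambda>n. K n (sample_path T X \<omega>))"
      using K NK by (rule conv)
    have 2: "AE \<omega> in P. summable (\<lambda>n. (cmod (K n (sample_path T X \<omega>) - F n (sample_path T X \<omega>)))\<^sup>2)"
    proof (rule AE_summable_if_integrals_summable)
      fix n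
      show "integrable P (\<lambda>\<omega>. (cmod (K n (sample_path T X \<omega>) - F n (sample_path T X \<omega>)))\<^sup>2)"
        by (rule diff_sq(1)[OF K F(1)])
      have "(\<integral>\<omega>. (cmod (K n (sample_path T X \<omega>) - F n (sample_path T X \<omega>)))\<^sup>2 \<partial>P) \<le> 2 * (N (K n) - D) + 2 * (N (F n) - D)"
        by (rule diff_sq(2)[OF K F(1)])
      also have "\<dots> \<le> 4 * (1 / 4) ^ n"
        using NK[of n] F(2)[of n] by simp
      finally show "(\<integral>\<omega>. (cmod (K n (sample_path T X \<omega>) - F n (sample_path T X \<omega>)))\<^sup>2 \<partial>P) \<le> 4 * (1 / 4) ^ n" .
    qed (auto intro!: summable_mult summable_geometric)
    from limG 1 2 show ?thesis
    proof eventually_elim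
      case (elim \<omega>)
      have "(\<lambda>n. (cmod (K n (sample_path T X \<omega>) - F n (sample_path T X \<omega>)))\<^sup>2) \<longlonglongrightarrow> 0"
        using elim(3) by (rule summable_LIMSEQ_zero)
      moreover have "(\<lambda>n. (cmod (K n (sample_path T X \<omega>) - F n (sample_path T X \<omega>)))\<^sup>2)
          \<longlonglongrightarrow> (cmod (lim (\<lambda>n. K n (sample_path T X \<omega>)) - G (sample_path T X \<omega>)))\<^sup>2"
        using elim(1,2) by (intro tendsto_intros)
      ultimately have "(cmod (lim (\<lambda>n. K n (sample_path T X \<omega>)) - G (sample_path T X \<omega>)))\<^sup>2 = 0"
        by (rule LIMSEQ_unique[rotated])
      then show ?case by (simp add: K_path G_def)
    qed
  qed
  have G_int: "integrable P (\<lambda>\<omega>. G (sample_path T X \<omega>))"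
  proof (rule integrable_const_bound[where B=1])
    show "AE \<omega> in P. cmod (G (sample_path T X \<omega>)) \<le> 1"
      using limG
    proof eventually_elim
      case (elim \<omega>)
      then show ?case
        by (rule Lim_norm_ubound[OF sequentially_bot]) (intro always_eventually allI H_bdd F(1))
    qed
  qed measurable
  obtain \<kappa> where \<kappa>: "AE \<omega> in P. G (sample_path T X \<omega>) = \<kappa>"
    using ergodic_invariant_const_complex[OF P erg X _ G_int G_inv] by auto
  have lim: "AE \<omega> in P. (\<lambda>n. F n (sample_path T X \<omega>)) \<longlonglongrightarrow> \<kappa>"
    using limG \<kappa> by eventually_elim simp
  show thesis
  proof (rule that[of F \<kappa>])
    have "(\<lambda>n. \<integral>\<omega>. F n (sample_path T X \<omega>) \<partial>P) \<longlonglongrightarrow> (\<integral>\<omega>. \<kappa> \<partial>P)"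
      using lim by (intro integral_dominated_convergence[where w="\<lambda>_. 1"])
        (auto intro!: AE_I2 H_bdd F comp_meas)
    then show "(\<lambda>n. \<integral>\<omega>. F n (sample_path T X \<omega>) \<partial>P) \<longlonglongrightarrow> \<kappa>"
      by (simp add: prob_space)
    have "(\<lambda>n. \<integral>\<omega>. (cmod (F n (sample_path T X \<omega>)))\<^sup>2 \<partial>P) \<longlonglongrightarrow> (\<integral>\<omega>. (cmod \<kappa>)\<^sup>2 \<partial>P)"
    proof (intro integral_dominated_convergence[where w="\<lambda>_. 1"])
      show "AE \<omega> in P. (\<lambda>n. (cmod (F n (sample_path T X \<omega>)))\<^sup>2) \<longlonglongrightarrow> (cmod \<kappa>)\<^sup>2"
        using lim by eventually_elim (intro tendsto_intros)
    qed (auto intro!: AE_I2 le1 F)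
    then show "(\<lambda>n. sq X (F n)) \<longlonglongrightarrow> (cmod \<kappa>)\<^sup>2"
      by (simp add: sq_def prob_space)
  qed (rule F)
qed

section \<open>Trigonometric convex combinations\<close>

definition trig_comb :: "real set \<Rightarrow> (real \<Rightarrow> real) \<Rightarrow> (real \<Rightarrow> real) \<Rightarrow> complex" where
  "trig_comb K w x = (\<Sum>t\<in>K. of_real (w t) * iexp (x t))"

lemma convex_weights_sum2:
  assumes "convex_weights T K w"
  shows "(\<Sum>i\<in>K. \<Sum>j\<in>K. w i * w j) = 1"
  using assms by (simp add: convex_weights_def flip: sum_product)

lemma norm_iexp [simp]: "cmod (iexp x) = 1"
  by simp

lemma trig_comb_norm_le:
  assumes "convex_weights T K w"
  shows "cmod (trig_comb K w x) \<le> 1"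
proof -
  have "cmod (trig_comb K w x) \<le> (\<Sum>t\<in>K. cmod (of_real (w t) * iexp (x t)))"
    unfolding trig_comb_def by (rule norm_sum)
  also have "\<dots> = sum w K"
    using assms by (intro sum.cong) (auto simp: convex_weights_def norm_mult)
  finally show ?thesis using assms by (simp add: convex_weights_def)
qed

lemma trig_comb_midpoint:
  assumes "convex_weights T K v" "convex_weights T L w"
  shows "\<exists>M u. convex_weights T M u \<and> (\<lambda>x. (trig_comb K v x + trig_comb L w x) / 2) = trig_comb M u"
proof -
  \<comment> \<open>\<open>convex_weights\<close> leaves the values off the index set free, so both
    weights are cut to 0 there before the index sets are merged.\<close>
  define v' where "v' t = (if t \<in> K then v t else 0)" for t
  define w' where "w' t = (if t \<in> L then w t else 0)" for t
  have fin: "finite K" "finite L" using assms by (auto simp: convex_weights_def)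
  have v: "trig_comb (K \<union> L) v' x = trig_comb K v x" "sum v' (K \<union> L) = sum v K" for x
    unfolding trig_comb_def using fin by (auto simp: v'_def intro!: sum.mono_neutral_cong_right)
  have w: "trig_comb (K \<union> L) w' x = trig_comb L w x" "sum w' (K \<union> L) = sum w L" for x
    unfolding trig_comb_def using fin by (auto simp: w'_def intro!: sum.mono_neutral_cong_right)
  show ?thesis
  proof (intro exI[of _ "K \<union> L"] exI[of _ "\<lambda>t. (v' t + w' t) / 2"] conjI ext)
    show "convex_weights T (K \<union> L) (\<lambda>t. (v' t + w' t) / 2)"
      using assms v(2) w(2)
      by (auto simp: convex_weights_def v'_def w'_def sum.distrib simp flip: sum_divide_distrib)
    fix x
    have "trig_comb (K \<union> L) (\<lambda>t. (v' t + w' t) / 2) x = (trig_comb (K \<union> L) v' x + trig_comb (K \<union> L) w' x) / 2"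
      by (simp add: trig_comb_def add_divide_distrib distrib_right sum.distrib sum_divide_distrib)
    then show "(trig_comb K v x + trig_comb L w x) / 2 = trig_comb (K \<union> L) (\<lambda>t. (v' t + w' t) / 2) x"
      by (simp add: v w)
  qed
qed

lemma trig_comb_shift:
  assumes "convex_weights T K w" "h \<in> T" and T: "\<And>s t. s \<in> T \<Longrightarrow> t \<in> T \<Longrightarrow> s + t \<in> T"
  shows "\<exists>M u. convex_weights T M u \<and> (\<lambda>x. trig_comb K w (\<lambda>t\<in>T. x (t + h))) = trig_comb M u"
proof (intro exI[of _ "(\<lambda>t. t + h) ` K"] exI[of _ "\<lambda>t. w (t - h)"] conjI ext)
  have inj: "inj_on (\<lambda>t. t + h) K" by (auto simp: inj_on_def)
  show "convex_weights T ((\<lambda>t. t + h) ` K) (\<lambda>t. w (t - h))"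
    using assms by (auto simp: convex_weights_def sum.reindex[OF inj])
  show "trig_comb K w (\<lambda>t\<in>T. x (t + h)) = trig_comb ((\<lambda>t. t + h) ` K) (\<lambda>t. w (t - h)) x" for x
    unfolding trig_comb_def sum.reindex[OF inj]
    using assms(1) by (intro sum.cong) (auto simp: convex_weights_def)
qed

lemma trig_comb_norm_square:
  "of_real ((cmod (trig_comb K w x))\<^sup>2) = (\<Sum>i\<in>K. \<Sum>j\<in>K. of_real (w i * w j) * iexp (x i - x j))"
proof -
  have "of_real ((cmod (trig_comb K w x))\<^sup>2) = trig_comb K w x * cnj (trig_comb K w x)"
    by (simp only: complex_norm_square)
  also have "\<dots> = (\<Sum>i\<in>K. \<Sum>j\<in>K. of_real (w i * w j) * iexp (x i - x j))"
    unfolding trig_comb_def cnj_sum sum_product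
    by (intro sum.cong refl) (simp add: exp_cnj right_diff_distrib exp_diff exp_minus field_simps)
  finally show ?thesis .
qed

lemma (in prob_space) trig_comb_second_moment:
  assumes U: "\<And>t. t \<in> T \<Longrightarrow> U t \<in> borel_measurable M"
    and d: "\<And>s t. s \<in> T \<Longrightarrow> t \<in> T \<Longrightarrow> (\<integral>\<omega>. iexp (U s \<omega> - U t \<omega>) \<partial>M) = of_real (exp (- d s t))"
    and w: "convex_weights T K w"
  shows "(\<integral>\<omega>. (cmod (trig_comb K w (sample_path T U \<omega>)))\<^sup>2 \<partial>M) = (\<Sum>i\<in>K. \<Sum>j\<in>K. w i * w j * exp (- d i j))"
proof -
  have K: "i \<in> T" if "i \<in> K" for i using w that by (auto simp: convex_weights_def)
  have int: "integrable M (\<lambda>\<omega>. iexp (U i \<omega> - U j \<omega>))" if "i \<in> K" "j \<in> K" for i j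
    using U[OF K] that by (intro integrable_const_bound[where B=1]) auto
  have "of_real (\<integral>\<omega>. (cmod (trig_comb K w (sample_path T U \<omega>)))\<^sup>2 \<partial>M)
    = (\<integral>\<omega>. complex_of_real ((cmod (trig_comb K w (sample_path T U \<omega>)))\<^sup>2) \<partial>M)"
    by (rule integral_complex_of_real[symmetric])
  also have "\<dots> = (\<integral>\<omega>. (\<Sum>i\<in>K. \<Sum>j\<in>K. of_real (w i * w j) * iexp (U i \<omega> - U j \<omega>)) \<partial>M)"
    unfolding trig_comb_norm_square
    using K by (intro Bochner_Integration.integral_cong sum.cong) (auto simp: sample_path_def)
  also have "\<dots> = (\<Sum>i\<in>K. \<Sum>j\<in>K. of_real (w i * w j) * (\<integral>\<omega>. iexp (U i \<omega> - U j \<omega>) \<partial>M))"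
    using int by (simp add: Bochner_Integration.integral_sum)
  also have "\<dots> = of_real (\<Sum>i\<in>K. \<Sum>j\<in>K. w i * w j * exp (- d i j))"
    using d K by simp
  finally show ?thesis by (simp only: of_real_eq_iff)
qed

lemma (in prob_space) trig_comb_expectation:
  assumes U: "\<And>t. t \<in> T \<Longrightarrow> U t \<in> borel_measurable M"
    and c: "\<And>t. t \<in> T \<Longrightarrow> (\<integral>\<omega>. iexp (U t \<omega>) \<partial>M) = of_real (exp (- c))"
    and w: "convex_weights T K w"
  shows "(\<integral>\<omega>. trig_comb K w (sample_path T U \<omega>) \<partial>M) = of_real (exp (- c))"
proof -
  have K: "i \<in> T" if "i \<in> K" for i using w that by (auto simp: convex_weights_def)
  have int: "integrable M (\<lambda>\<omega>. iexp (U i \<omega>))" if "i \<in> K" for i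
    using U[OF K] that by (intro integrable_const_bound[where B=1]) auto
  have "(\<integral>\<omega>. trig_comb K w (sample_path T U \<omega>) \<partial>M) = (\<integral>\<omega>. (\<Sum>i\<in>K. of_real (w i) * iexp (U i \<omega>)) \<partial>M)"
    unfolding trig_comb_def
    using K by (intro Bochner_Integration.integral_cong sum.cong) (auto simp: sample_path_def)
  also have "\<dots> = (\<Sum>i\<in>K. of_real (w i) * (\<integral>\<omega>. iexp (U i \<omega>) \<partial>M))"
    using int by (simp add: Bochner_Integration.integral_sum)
  also have "\<dots> = of_real (sum w K) * of_real (exp (- c))"
    using c K by (simp add: sum_distrib_right)
  finally show ?thesis using w by (simp add: convex_weights_def del: of_real_sum)
qed

text \<open>Jensen's inequality for the product weights, through the tangent of exp at the negative
  of the mean m: each \<open>exp (- d i j)\<close> is at least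
  \<open>exp (- m) * (1 + (m - d i j))\<close>, and the second factor averages to 1.\<close>

lemma exp_neg_jensen2:
  fixes d :: "real \<Rightarrow> real \<Rightarrow> real"
  assumes w: "convex_weights T K w"
  shows "exp (- (\<Sum>i\<in>K. \<Sum>j\<in>K. w i * w j * d i j)) \<le> (\<Sum>i\<in>K. \<Sum>j\<in>K. w i * w j * exp (- d i j))"
proof -
  define m where "m = (\<Sum>i\<in>K. \<Sum>j\<in>K. w i * w j * d i j)"
  have "(\<Sum>i\<in>K. \<Sum>j\<in>K. w i * w j * (1 + m - d i j)) = (1 + m) * (\<Sum>i\<in>K. \<Sum>j\<in>K. w i * w j) - (\<Sum>i\<in>K. \<Sum>j\<in>K. w i * w j * d i j)"
    by (simp add: right_diff_distrib sum_subtractf sum_distrib_left mult_ac)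
  then have "exp (- m) = exp (- m) * (\<Sum>i\<in>K. \<Sum>j\<in>K. w i * w j * (1 + m - d i j))"
    by (simp add: convex_weights_sum2[OF w] m_def[symmetric])
  also have "\<dots> = (\<Sum>i\<in>K. \<Sum>j\<in>K. w i * w j * (exp (- m) * (1 + (m - d i j))))"
    by (simp add: sum_distrib_left mult_ac add_diff_eq)
  also have "\<dots> \<le> (\<Sum>i\<in>K. \<Sum>j\<in>K. w i * w j * exp (- d i j))"
  proof (intro sum_mono mult_left_mono)
    fix i j assume "i \<in> K" "j \<in> K"
    have "exp (- m) * (1 + (m - d i j)) \<le> exp (- m) * exp (m - d i j)"
      by (intro mult_left_mono exp_ge_add_one_self) auto
    then show "exp (- m) * (1 + (m - d i j)) \<le> exp (- d i j)"
      by (simp flip: exp_add)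
    show "0 \<le> w i * w j" using w \<open>i \<in> K\<close> \<open>j \<in> K\<close> by (auto simp: convex_weights_def)
  qed
  finally show ?thesis by (simp add: m_def)
qed

text \<open>Under ergodicity the minimising sequence tends to a constant, which the common mean
  identifies as \<open>exp (- c)\<close>, with squared modulus \<open>exp (- (2 * c))\<close>.
  Jensen and the gap keep all squared norms above \<open>exp (- (2 * c - \<delta>))\<close>, which
  is strictly larger.\<close>

lemma not_ergodic_if_gap:
  fixes U :: "real \<Rightarrow> 'w \<Rightarrow> real" and d :: "real \<Rightarrow> real \<Rightarrow> real"
  assumes P: "prob_space P"
    and U: "\<And>t. t \<in> T \<Longrightarrow> U t \<in> borel_measurable P"
    and T: "\<And>s t. s \<in> T \<Longrightarrow> t \<in> T \<Longrightarrow> s + t \<in> T" "T \<noteq> {}"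
    and c: "\<And>t. t \<in> T \<Longrightarrow> (\<integral>\<omega>. iexp (U t \<omega>) \<partial>P) = of_real (exp (- c))"
    and d: "\<And>s t. s \<in> T \<Longrightarrow> t \<in> T \<Longrightarrow> (\<integral>\<omega>. iexp (U s \<omega> - U t \<omega>) \<partial>P) = of_real (exp (- d s t))"
    and d_shift: "\<And>s t h. s \<in> T \<Longrightarrow> t \<in> T \<Longrightarrow> h \<in> T \<Longrightarrow> d (s + h) (t + h) = d s t"
    and gap: "\<And>K w. convex_weights T K w \<Longrightarrow> (\<Sum>i\<in>K. \<Sum>j\<in>K. w i * w j * d i j) \<le> 2 * c - \<delta>"
    and \<delta>: "0 < \<delta>"
  shows "\<not> ergodic T P U"
proof
  assume erg: "ergodic T P U"
  interpret prob_space P by fact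
  define H where "H = {trig_comb K w |K w. convex_weights T K w}"
  let ?sq = "\<lambda>X F. \<integral>\<omega>. (cmod (F (sample_path T X \<omega>)))\<^sup>2 \<partial>P"
  note sq = trig_comb_second_moment[where U=U, OF U d]
  have sq_shift: "?sq (\<lambda>t. U (t + h)) F = ?sq U F" if F: "F \<in> H" and h: "h \<in> T" for F h
  proof -
    from F obtain K w where w: "convex_weights T K w" and F: "F = trig_comb K w" by (auto simp: H_def)
    have "?sq (\<lambda>t. U (t + h)) F = (\<Sum>i\<in>K. \<Sum>j\<in>K. w i * w j * exp (- d i j))"
      unfolding F
    \<comment> \<open>Second moments see only the increments, so the shifted process satisfies the
      formula with the same \<open>d\<close>.\<close>
    proof (rule trig_comb_second_moment[OF _ _ w])
      show "U (t + h) \<in> borel_measurable P" if "t \<in> T" for t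
        using U T(1) that h by blast
      show "(\<integral>\<omega>. iexp (U (s + h) \<omega> - U (t + h) \<omega>) \<partial>P) = of_real (exp (- d s t))" if "s \<in> T" "t \<in> T" for s t
        using d[OF T(1)[OF that(1) h] T(1)[OF that(2) h]] by (simp only: d_shift[OF that h])
    qed
    then show ?thesis unfolding F by (simp add: sq[OF _ _ _ w])
  qed
  obtain F \<kappa> where F: "\<And>n. F n \<in> H"
    and lim1: "(\<lambda>n. \<integral>\<omega>. F n (sample_path T U \<omega>) \<partial>P) \<longlonglongrightarrow> \<kappa>"
    and lim2: "(\<lambda>n. ?sq U (F n)) \<longlonglongrightarrow> (cmod \<kappa>)\<^sup>2"
  proof (rule ergodic_minimizing_sequence[OF P erg U T(1), of H])
    obtain t where "t \<in> T" using T(2) by blast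
    then have "convex_weights T {t} (\<lambda>_. 1)" by (simp add: convex_weights_def)
    then show "H \<noteq> {}" unfolding H_def by blast
  next
    fix F assume "F \<in> H"
    then obtain K w where w: "convex_weights T K w" and F: "F = trig_comb K w" by (auto simp: H_def)
    then have "(\<lambda>x. x t) \<in> borel_measurable (\<Pi>\<^sub>M t\<in>T. (borel :: real measure))" if "t \<in> K" for t
      using that by (intro measurable_component_singleton) (auto simp: convex_weights_def)
    then show "F \<in> borel_measurable (\<Pi>\<^sub>M t\<in>T. borel)"
      unfolding F trig_comb_def by (intro borel_measurable_sum borel_measurable_times) auto
    show "cmod (F x) \<le> 1" for x unfolding F by (rule trig_comb_norm_le[OF w])
    show "(\<lambda>x. F (\<lambda>t\<in>T. x (t + h))) \<in> H" if "h \<in> T" for h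
      using trig_comb_shift[OF w that T(1)] by (simp add: H_def F conj_commute)
    fix G assume "G \<in> H"
    then obtain L v where v: "convex_weights T L v" and G: "G = trig_comb L v" by (auto simp: H_def)
    show "(\<lambda>x. (F x + G x) / 2) \<in> H"
      using trig_comb_midpoint[OF w v] by (simp add: H_def F G conj_commute)
  qed (use sq_shift in auto)
  have "(\<integral>\<omega>. F n (sample_path T U \<omega>) \<partial>P) = of_real (exp (- c))" for n
    using F[of n] trig_comb_expectation[where U=U, OF U c] by (auto simp: H_def)
  then have "\<kappa> = of_real (exp (- c))"
    using lim1 by (simp add: LIMSEQ_const_iff)
  then have "(cmod \<kappa>)\<^sup>2 = exp (- (2 * c))"
    by (simp add: power2_eq_square flip: exp_add)
  moreover have "exp (- (2 * c - \<delta>)) \<le> (cmod \<kappa>)\<^sup>2"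
  proof (rule LIMSEQ_le_const[OF lim2], intro exI allI impI)
    fix n
    obtain K w where w: "convex_weights T K w" and Fn: "F n = trig_comb K w" using F[of n] by (auto simp: H_def)
    have "exp (- (2 * c - \<delta>)) \<le> exp (- (\<Sum>i\<in>K. \<Sum>j\<in>K. w i * w j * d i j))"
      using gap[OF w] by simp
    also have "\<dots> \<le> ?sq U (F n)"
      unfolding Fn by (subst sq[OF _ _ _ w]) (use exp_neg_jensen2[OF w] in auto)
    finally show "exp (- (2 * c - \<delta>)) \<le> ?sq U (F n)" .
  qed
  ultimately show False using \<delta> by simp
qed

section \<open>The cyclic kernel\<close>

lemma space_time_measure: "T = \<int> \<or> T = UNIV \<Longrightarrow> space (time_measure T) = T"
  by (auto simp: time_measure_def)

lemma sigma_finite_time_measure: "sigma_finite_measure (time_measure T)"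
proof -
  have "countable (\<int> :: real set)"
    unfolding Ints_def by (rule countable_image) auto
  then show ?thesis
    by (auto simp: time_measure_def lborel.sigma_finite_measure_axioms intro: sigma_finite_measure_count_space_countable)
qed

lemma time_set_add: "T = \<int> \<or> T = UNIV \<Longrightarrow> s \<in> T \<Longrightarrow> t \<in> T \<Longrightarrow> s + t \<in> T" for T :: "real set"
  by auto

lemma measurable_time_measure_id: "(\<lambda>v. v) \<in> borel_measurable (time_measure T)"
  by (simp add: time_measure_def)

lemma measurable_time_measure_shift:
  assumes "T = \<int> \<or> T = UNIV" "a \<in> T"
  shows "(\<lambda>v. v + a) \<in> measurable (time_measure T) (time_measure T)"
  using assms by (auto simp: time_measure_def)

lemma nn_integral_time_measure_shift:
  fixes f :: "real \<Rightarrow> ennreal"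
  assumes T: "T = \<int> \<or> T = UNIV" "a \<in> T" and f: "f \<in> borel_measurable (time_measure T)"
  shows "(\<integral>\<^sup>+v. f (v + a) \<partial>time_measure T) = (\<integral>\<^sup>+v. f v \<partial>time_measure T)"
proof (cases "T = \<int>")
  case True
  then have "bij_betw (\<lambda>v. v + a) \<int> (\<int> :: real set)"
    using T by (intro bij_betwI[where g="\<lambda>v. v - a"]) auto
  then show ?thesis
    using True nn_integral_bij_count_space[of "\<lambda>v. v + a" \<int> \<int> f] by (simp add: time_measure_def)
next
  case False
  then have "f \<in> borel_measurable borel" using f by (simp add: time_measure_def)
  then show ?thesis
    using nn_integral_real_affine[of f 1 a] False by (simp add: time_measure_def add.commute)
qed

lemma wrap_eqI:
  assumes "x = y + q * of_int n" "0 \<le> y" "y < q"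
  shows "wrap q x = y"
proof -
  have "q > 0" using assms by simp
  then have "wrap_index q x = n"
    using assms by (simp add: wrap_index_eq_floor add_divide_distrib floor_unique)
  then show ?thesis using assms by (simp add: wrap_def)
qed

lemma wrap_bounds:
  assumes "q > 0"
  shows "0 \<le> wrap q x" "wrap q x < q"
proof -
  show "0 \<le> wrap q x" "wrap q x < q"
    using assms floor_divide_lower[OF assms, of x] floor_divide_upper[OF assms, of x]
    by (simp_all add: wrap_def wrap_index_eq_floor algebra_simps)
qed

text \<open>Invariance under rotation of a circle of length q. Only the remainder r of t matters;
  the interval is cut at q - r, and its two pieces are translated by r and by r - q.\<close>

lemma nn_integral_wrap:
  fixes F :: "real \<Rightarrow> ennreal"
  assumes T: "T = \<int> \<or> T = UNIV" and q: "q \<in> time_pos T" and t: "t \<in> T"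
    and F[measurable]: "F \<in> borel_measurable (time_measure T)"
  shows "(\<integral>\<^sup>+v. indicator {0..<q} v * F (wrap q (v + t)) \<partial>time_measure T)
      = (\<integral>\<^sup>+v. indicator {0..<q} v * F v \<partial>time_measure T)"
proof -
  note [measurable] = measurable_time_measure_id
  have q0: "q > 0" and qT: "q \<in> T" using q T by (auto simp: time_pos_def split: if_splits)
  define r where "r = wrap q t"
  have r: "0 \<le> r" "r < q" using wrap_bounds[OF q0] by (auto simp: r_def)
  have t_eq: "t = r + q * of_int (wrap_index q t)" by (simp add: r_def wrap_def)
  \<comment> \<open>For integer times this relies on q being an integer; both translations then
    preserve the measure on \<open>T\<close>.\<close>
  have rT: "r \<in> T" "r - q \<in> T"
    using T t qT by (auto simp: r_def wrap_def)
  \<comment> \<open>\<open>A\<close> lives on the image of the points that do not wrap,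
    \<open>B\<close> on the image of those that do.\<close>
  define A where "A u = indicator {r..<q} u * F u" for u
  define B where "B u = indicator {0..<r} u * F u" for u
  have A: "A \<in> borel_measurable (time_measure T)" and B: "B \<in> borel_measurable (time_measure T)"
    unfolding A_def B_def by measurable
  have mB: "(\<lambda>v. B (v + (r - q))) \<in> borel_measurable (time_measure T)"
    by (rule measurable_compose[OF measurable_time_measure_shift[OF T rT(2)] B])
  have mA: "(\<lambda>v. A (v + r)) \<in> borel_measurable (time_measure T)"
    by (rule measurable_compose[OF measurable_time_measure_shift[OF T rT(1)] A])
  have "indicator {0..<q} v * F (wrap q (v + t)) = A (v + r) + B (v + (r - q))" for v
  proof -
    consider "v \<notin> {0..<q}" | "0 \<le> v" "v + r < q" | "v < q" "q \<le> v + r" by force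
    then show ?thesis
    proof cases
      case 1
      then show ?thesis using r by (auto simp: A_def B_def indicator_def)
    next
      case 2
      then have "wrap q (v + t) = v + r"
        using t_eq r by (intro wrap_eqI[where n="wrap_index q t"]) auto
      then show ?thesis using 2 r by (auto simp: A_def B_def indicator_def)
    next
      case 3
      then have "wrap q (v + t) = v + (r - q)"
        using t_eq r by (intro wrap_eqI[where n="wrap_index q t + 1"]) (auto simp: algebra_simps)
      then show ?thesis using 3 r by (auto simp: A_def B_def indicator_def)
    qed
  qed
  then have "(\<integral>\<^sup>+v. indicator {0..<q} v * F (wrap q (v + t)) \<partial>time_measure T)
      = (\<integral>\<^sup>+v. A (v + r) + B (v + (r - q)) \<partial>time_measure T)" by simp
  also have "\<dots> = (\<integral>\<^sup>+v. A v \<partial>time_measure T) + (\<integral>\<^sup>+v. B v \<partial>time_measure T)"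
    using mA mB by (simp add: nn_integral_add nn_integral_time_measure_shift[OF T rT(1) A] nn_integral_time_measure_shift[OF T rT(2) B])
  also have "\<dots> = (\<integral>\<^sup>+v. A v + B v \<partial>time_measure T)"
    using A B by (simp add: nn_integral_add)
  also have "\<dots> = (\<integral>\<^sup>+v. indicator {0..<q} v * F v \<partial>time_measure T)"
    using r by (intro nn_integral_cong) (auto simp: A_def B_def indicator_def)
  finally show ?thesis .
qed

text \<open>For integer times q is an integer, so counting gives exactly q. The bound controls the
  mass of a fibre in the square integral of the weight.\<close>

lemma nn_integral_time_measure_interval_le:
  assumes T: "T = \<int> \<or> T = UNIV" and q: "q \<in> time_pos T"
  shows "(\<integral>\<^sup>+v. indicator {0..<q} v \<partial>time_measure T) \<le> ennreal q"
proof (cases "T = \<int>")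
  case True
  with q obtain k where k: "q = of_int k" "k \<ge> 2"
    by (auto simp: time_pos_def elim!: Ints_cases)
  have "{0..<q} \<inter> \<int> = of_int ` {0..<k}"
    using k by (auto elim!: Ints_cases)
  then have card: "card ({0..<q} \<inter> \<int>) = nat k" "finite ({0..<q} \<inter> \<int>)"
    by (auto simp: card_image inj_on_def)
  have "(\<integral>\<^sup>+v. indicator {0..<q} v \<partial>time_measure T)
      = (\<integral>\<^sup>+v. indicator ({0..<q} \<inter> \<int>) v \<partial>count_space \<int>)"
    using True by (auto simp: time_measure_def indicator_def intro!: nn_integral_cong)
  also have "\<dots> = emeasure (count_space \<int>) ({0..<q} \<inter> \<int>)"
    by (subst nn_integral_indicator) auto
  also have "\<dots> = ennreal q"
    using card k by (simp add: ennreal_of_nat_eq_real_of_nat)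
  finally show ?thesis by simp
next
  case False
  then have "q > 0" using q by (simp add: time_pos_def)
  then show ?thesis using False by (simp add: time_measure_def)
qed

section \<open>Integration over the cyclic space and its invariant weight\<close>

lemma cyclic_domain_measurable:
  assumes T: "T = \<int> \<or> T = UNIV" and [measurable]: "q \<in> borel_measurable \<sigma>"
  shows "{(z, v). z \<in> space \<sigma> \<and> v \<in> T \<and> 0 \<le> v \<and> v < q z} \<inter> space (\<sigma> \<Otimes>\<^sub>M time_measure T)
     \<in> sets (\<sigma> \<Otimes>\<^sub>M time_measure T)"
proof -
  have "{x \<in> space (\<sigma> \<Otimes>\<^sub>M time_measure T). 0 \<le> snd x \<and> snd x < q (fst x)} \<in> sets (\<sigma> \<Otimes>\<^sub>M time_measure T)"
  proof -
    have [measurable]: "snd \<in> borel_measurable (\<sigma> \<Otimes>\<^sub>M time_measure T)"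
      by (rule measurable_compose[OF measurable_snd measurable_time_measure_id])
    show ?thesis by measurable
  qed
  also have "{x \<in> space (\<sigma> \<Otimes>\<^sub>M time_measure T). 0 \<le> snd x \<and> snd x < q (fst x)}
     = {(z, v). z \<in> space \<sigma> \<and> v \<in> T \<and> 0 \<le> v \<and> v < q z} \<inter> space (\<sigma> \<Otimes>\<^sub>M time_measure T)"
    using space_time_measure[OF T] by (auto simp: space_pair_measure)
  finally show ?thesis .
qed

text \<open>Tonelli on the product, with the domain turned into an indicator. The measurability of
  sections feeds the fibrewise use of \<open>nn_integral_wrap\<close>.\<close>

lemma nn_integral_cyclic_space:
  fixes f :: "'z \<times> real \<Rightarrow> ennreal"
  assumes T: "T = \<int> \<or> T = UNIV" and q: "q \<in> borel_measurable \<sigma>"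
    and f: "f \<in> borel_measurable (cyclic_space T \<sigma> q)"
  shows "(\<integral>\<^sup>+s. f s \<partial>cyclic_space T \<sigma> q)
      = (\<integral>\<^sup>+z. \<integral>\<^sup>+v. indicator {0..<q z} v * f (z, v) \<partial>time_measure T \<partial>\<sigma>)"
    and "z \<in> space \<sigma> \<Longrightarrow> (\<lambda>v. indicator {0..<q z} v * f (z, v)) \<in> borel_measurable (time_measure T)"
proof -
  interpret L: sigma_finite_measure "time_measure T" by (rule sigma_finite_time_measure)
  let ?\<Omega> = "{(z, v). z \<in> space \<sigma> \<and> v \<in> T \<and> 0 \<le> v \<and> v < q z}"
  note \<Omega> = cyclic_domain_measurable[OF T q]
  have m: "(\<lambda>s. f s * indicator ?\<Omega> s) \<in> borel_measurable (\<sigma> \<Otimes>\<^sub>M time_measure T)"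
    using f unfolding cyclic_space_def by (subst (asm) borel_measurable_restrict_space_iff_ennreal[OF \<Omega>])
  have eq: "f (z, v) * indicator ?\<Omega> (z, v) = indicator {0..<q z} v * f (z, v)"
    if "z \<in> space \<sigma>" "v \<in> space (time_measure T)" for z v
    using that space_time_measure[OF T] by (auto simp: indicator_def)
  have "(\<integral>\<^sup>+s. f s \<partial>cyclic_space T \<sigma> q) = (\<integral>\<^sup>+s. f s * indicator ?\<Omega> s \<partial>(\<sigma> \<Otimes>\<^sub>M time_measure T))"
    unfolding cyclic_space_def by (rule nn_integral_restrict_space[OF \<Omega>])
  also have "\<dots> = (\<integral>\<^sup>+z. \<integral>\<^sup>+v. f (z, v) * indicator ?\<Omega> (z, v) \<partial>time_measure T \<partial>\<sigma>)"
    by (rule L.nn_integral_fst[symmetric, OF m])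
  also have "\<dots> = (\<integral>\<^sup>+z. \<integral>\<^sup>+v. indicator {0..<q z} v * f (z, v) \<partial>time_measure T \<partial>\<sigma>)"
    by (intro nn_integral_cong eq)
  finally show "(\<integral>\<^sup>+s. f s \<partial>cyclic_space T \<sigma> q)
      = (\<integral>\<^sup>+z. \<integral>\<^sup>+v. indicator {0..<q z} v * f (z, v) \<partial>time_measure T \<partial>\<sigma>)" .
  show "(\<lambda>v. indicator {0..<q z} v * f (z, v)) \<in> borel_measurable (time_measure T)" if z: "z \<in> space \<sigma>"
  proof -
    have "(\<lambda>v. f (z, v) * indicator ?\<Omega> (z, v)) \<in> borel_measurable (time_measure T)"
      using measurable_compose[OF measurable_Pair1'[OF z] m] by simp
    then show ?thesis by (subst (asm) measurable_cong[OF eq[OF z]])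
  qed
qed

lemma measurable_cyclic_space_fst:
  "fst \<in> measurable (cyclic_space T \<sigma> q) \<sigma>"
  unfolding cyclic_space_def by (intro measurable_restrict_space1) measurable

text \<open>
  The weight depends on \<open>z\<close> only, so that integrating it against a function of \<open>\<bar>f t\<bar>\<close> gives a
  value independent of \<open>t\<close>: on each fibre \<open>t\<close> acts by a rotation of \<open>[0, q z)\<close>.
\<close>

lemma cyclic_invariant_weight:
  fixes g :: "'z \<times> real \<Rightarrow> 'a::{real_normed_field, second_countable_topology}"
  assumes T: "T = \<int> \<or> T = UNIV" and \<sigma>: "sigma_finite_measure \<sigma>"
    and q[measurable]: "q \<in> borel_measurable \<sigma>" and q_pos: "AE z in \<sigma>. q z \<in> time_pos T"
    and g: "g \<in> borel_measurable (cyclic_space T \<sigma> q)"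
    and b: "\<And>z. z \<in> space \<sigma> \<Longrightarrow> norm (b z) = 1"
    and f: "\<And>t. t \<in> T \<Longrightarrow> cyclic_kernel q b g t \<in> borel_measurable (cyclic_space T \<sigma> q)"
  shows "invariant_weight T (cyclic_space T \<sigma> q) (cyclic_kernel q b g)"
proof -
  define h where "h r = 1 - exp (- r\<^sup>2)" for r :: real
  have [measurable]: "h \<in> borel_measurable borel" unfolding h_def by measurable
  let ?N = "cyclic_space T \<sigma> q"
  interpret S: sigma_finite_measure \<sigma> by fact
  note [measurable] = measurable_time_measure_id
  obtain p where p[measurable]: "p \<in> borel_measurable \<sigma>" and p_fin: "integral\<^sup>N \<sigma> p \<noteq> \<infinity>"
    and p_pos: "\<And>z. z \<in> space \<sigma> \<Longrightarrow> 0 < p z \<and> p z < \<infinity>"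
    using S.Ex_finite_integrable_function by blast
  \<comment> \<open>The square is integrated over a fibre of mass at most \<open>q z\<close>, so
    dividing by \<open>1 + \<bar>q z\<bar>\<close> leaves at most the integrable \<open>p z\<close>.
    This denominator stays positive also where \<open>q\<close> is not a valid period.\<close>
  define \<phi> where "\<phi> z = sqrt (enn2real (p z) / (1 + \<bar>q z\<bar>))" for z
  have \<phi>_m: "\<phi> \<in> borel_measurable \<sigma>" unfolding \<phi>_def by measurable
  have \<phi>_pos: "0 < \<phi> z" if "z \<in> space \<sigma>" for z
    using p_pos[OF that] by (auto simp: \<phi>_def enn2real_positive_iff intro!: divide_pos_pos)
  have space_fst: "fst s \<in> space \<sigma>" if "s \<in> space ?N" for s
    using that by (auto simp: cyclic_space_def space_restrict_space space_pair_measure)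
  have \<psi>_m[measurable]: "(\<lambda>s. \<phi> (fst s)) \<in> borel_measurable ?N"
    by (rule measurable_compose[OF measurable_cyclic_space_fst \<phi>_m])
  have "(\<integral>\<^sup>+s. ennreal ((\<phi> (fst s))\<^sup>2) \<partial>?N) = (\<integral>\<^sup>+z. \<integral>\<^sup>+v. indicator {0..<q z} v * ennreal ((\<phi> z)\<^sup>2) \<partial>time_measure T \<partial>\<sigma>)"
    by (subst nn_integral_cyclic_space[OF T q]) auto
  also have "\<dots> \<le> (\<integral>\<^sup>+z. p z \<partial>\<sigma>)"
  proof (rule nn_integral_mono_AE, rule AE_mp[OF q_pos], intro AE_I2 impI)
    fix z assume z: "z \<in> space \<sigma>" "q z \<in> time_pos T"
    have "(\<integral>\<^sup>+v. indicator {0..<q z} v * ennreal ((\<phi> z)\<^sup>2) \<partial>time_measure T)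
      = (\<integral>\<^sup>+v. indicator {0..<q z} v \<partial>time_measure T) * ennreal ((\<phi> z)\<^sup>2)"
      by (intro nn_integral_multc) measurable
    also have "\<dots> \<le> ennreal (q z) * ennreal ((\<phi> z)\<^sup>2)"
      by (intro mult_right_mono nn_integral_time_measure_interval_le T z) auto
    also have "\<dots> = ennreal (q z * (\<phi> z)\<^sup>2)"
      by (simp add: ennreal_mult'')
    also have "\<dots> \<le> ennreal (enn2real (p z))"
    proof (intro ennreal_leI)
      have "q z * (\<phi> z)\<^sup>2 = enn2real (p z) * (q z / (1 + \<bar>q z\<bar>))"
        by (simp add: \<phi>_def)
      also have "\<dots> \<le> enn2real (p z) * 1"
        by (intro mult_left_mono) (auto simp: divide_le_eq)
      finally show "q z * (\<phi> z)\<^sup>2 \<le> enn2real (p z)" by simp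
    qed
    also have "\<dots> = p z" using p_pos[OF z(1)] by (simp add: ennreal_enn2real_if less_top)
    finally show "(\<integral>\<^sup>+v. indicator {0..<q z} v * ennreal ((\<phi> z)\<^sup>2) \<partial>time_measure T) \<le> p z" .
  qed
  also have "\<dots> < \<infinity>" using p_fin by (simp add: less_top)
  finally have fin: "(\<integral>\<^sup>+s. ennreal ((\<phi> (fst s))\<^sup>2) \<partial>?N) < \<infinity>" .
  have int: "integrable ?N (\<lambda>s. (\<phi> (fst s))\<^sup>2)"
    using fin by (intro integrableI_bounded) auto
  define A where "A = (\<integral>\<^sup>+s. ennreal (\<phi> (fst s) * h (norm (g s))) \<partial>?N)"
  have "(\<integral>\<^sup>+s. ennreal (\<phi> (fst s) * h (norm (cyclic_kernel q b g t s))) \<partial>?N) = A" if t: "t \<in> T" for t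
  proof -
    note [measurable] = f[OF t] g
    have m1: "(\<lambda>s. ennreal (\<phi> (fst s) * h (norm (cyclic_kernel q b g t s)))) \<in> borel_measurable ?N"
      by measurable
    have m2: "(\<lambda>s. ennreal (\<phi> (fst s) * h (norm (g s)))) \<in> borel_measurable ?N"
      by measurable
    have "(\<integral>\<^sup>+s. ennreal (\<phi> (fst s) * h (norm (cyclic_kernel q b g t s))) \<partial>?N)
       = (\<integral>\<^sup>+z. \<integral>\<^sup>+v. indicator {0..<q z} v * ennreal (\<phi> z * h (norm (cyclic_kernel q b g t (z, v)))) \<partial>time_measure T \<partial>\<sigma>)"
      using nn_integral_cyclic_space(1)[OF T q m1] by simp
    also have "\<dots> = (\<integral>\<^sup>+z. \<integral>\<^sup>+v. indicator {0..<q z} v * ennreal (\<phi> z * h (norm (g (z, v)))) \<partial>time_measure T \<partial>\<sigma>)"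
    proof (rule nn_integral_cong_AE, rule AE_mp[OF q_pos], intro AE_I2 impI)
      fix z assume z: "z \<in> space \<sigma>" "q z \<in> time_pos T"
      have q0: "0 < q z" using z(2) by (auto simp: time_pos_def split: if_splits)
      \<comment> \<open>\<open>g\<close> is measurable on the cyclic space only; the indicator makes
        \<open>F\<close> measurable on the whole time axis and equals 1 at every wrapped point. The
        factor \<open>b\<close> disappears under the norm.\<close>
      define F where "F v = indicator {0..<q z} v * ennreal (\<phi> z * h (norm (g (z, v))))" for v
      have F: "F \<in> borel_measurable (time_measure T)"
        using nn_integral_cyclic_space(2)[OF T q m2 z(1)] unfolding F_def by simp
      have "indicator {0..<q z} v * ennreal (\<phi> z * h (norm (cyclic_kernel q b g t (z, v))))
          = indicator {0..<q z} v * F (wrap (q z) (v + t))" for v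
        using wrap_bounds[OF q0, of "v + t"]
        by (simp add: F_def cyclic_kernel_def norm_mult norm_power_int b[OF z(1)])
      then have "(\<integral>\<^sup>+v. indicator {0..<q z} v * ennreal (\<phi> z * h (norm (cyclic_kernel q b g t (z, v)))) \<partial>time_measure T)
          = (\<integral>\<^sup>+v. indicator {0..<q z} v * F (wrap (q z) (v + t)) \<partial>time_measure T)"
        by simp
      also have "\<dots> = (\<integral>\<^sup>+v. indicator {0..<q z} v * F v \<partial>time_measure T)"
        by (rule nn_integral_wrap[OF T z(2) t F])
      also have "\<dots> = (\<integral>\<^sup>+v. indicator {0..<q z} v * ennreal (\<phi> z * h (norm (g (z, v)))) \<partial>time_measure T)"
        by (intro nn_integral_cong) (auto simp: F_def indicator_def)
      finally show "(\<integral>\<^sup>+v. indicator {0..<q z} v * ennreal (\<phi> z * h (norm (cyclic_kernel q b g t (z, v)))) \<partial>time_measure T)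
        = (\<integral>\<^sup>+v. indicator {0..<q z} v * ennreal (\<phi> z * h (norm (g (z, v)))) \<partial>time_measure T)" .
    qed
    also have "\<dots> = A"
      using nn_integral_cyclic_space(1)[OF T q m2] by (simp add: A_def)
    finally show ?thesis .
  qed
  then show ?thesis
    unfolding invariant_weight_def h_def[symmetric]
    using int \<phi>_pos space_fst by (intro exI[of _ "\<lambda>s. \<phi> (fst s)"] exI[of _ A]) auto
qed

section \<open>Increments of the summands\<close>

text \<open>For a finite measure the constant weight 1 is square integrable.\<close>

lemma invariant_weight_if_norm_constant:
  assumes "finite_measure \<mu>" and eq: "\<And>s t u. s \<in> space \<mu> \<Longrightarrow> t \<in> T \<Longrightarrow> u \<in> T \<Longrightarrow> norm (f t s) = norm (f u s)"
  shows "invariant_weight T \<mu> f"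
proof -
  interpret finite_measure \<mu> by fact
  \<comment> \<open>The choice term names a common reference time; for empty \<open>T\<close> the
    claim is vacuous.\<close>
  have "(\<integral>\<^sup>+s. ennreal (1 * (1 - exp (- (norm (f t s))\<^sup>2))) \<partial>\<mu>)
      = (\<integral>\<^sup>+s. ennreal (1 * (1 - exp (- (norm (f (SOME u. u \<in> T) s))\<^sup>2))) \<partial>\<mu>)" if "t \<in> T" for t
  proof (rule nn_integral_cong)
    fix s assume "s \<in> space \<mu>"
    moreover have "(SOME u. u \<in> T) \<in> T" using that by (rule someI)
    ultimately show "ennreal (1 * (1 - exp (- (norm (f t s))\<^sup>2)))
      = ennreal (1 * (1 - exp (- (norm (f (SOME u. u \<in> T) s))\<^sup>2)))"
      using eq[of s t "SOME u. u \<in> T"] that by simp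
  qed
  then show ?thesis
    unfolding invariant_weight_def by (intro exI[of _ "\<lambda>_. 1"]) auto
qed

text \<open>Mentions only characteristic functions and no kernel, so that two summands with
  unrelated control measures can be combined by adding c, d and \<delta>. A zero gap is allowed
  exactly for the sake of a summand with c = 0.\<close>

definition increment_gap :: "real set \<Rightarrow> 'v measure \<Rightarrow> (real \<Rightarrow> 'v \<Rightarrow> real) \<Rightarrow> bool" where
  "increment_gap T Q V \<longleftrightarrow> (\<exists>c d \<delta>. 0 \<le> c \<and> 0 \<le> \<delta> \<and> (c \<noteq> 0 \<longrightarrow> 0 < \<delta>) \<and>
     (\<forall>t\<in>T. (\<integral>\<omega>. iexp (V t \<omega>) \<partial>Q) = of_real (exp (- c))) \<and>
     (\<forall>s\<in>T. \<forall>t\<in>T. (\<integral>\<omega>. iexp (V s \<omega> - V t \<omega>) \<partial>Q) = of_real (exp (- d s t))) \<and>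
     (\<forall>K w. convex_weights T K w \<longrightarrow> (\<Sum>i\<in>K. \<Sum>j\<in>K. w i * w j * d i j) \<le> 2 * c - \<delta>))"

text \<open>The factor k is 1 in the real case and \<open>c0 \<alpha>\<close> in the complex case.
  Stationarity makes the integral of \<open>norm (f t s) powr \<alpha>\<close> independent of t.
  Increments are given for distinct times, as the characteristic functions are indexed by finite
  sets; for s = t both sides are 1.\<close>

lemma increment_gapI:
  fixes f :: "real \<Rightarrow> 's \<Rightarrow> 'b::euclidean_space"
  assumes Q: "prob_space Q" and \<alpha>: "0 < \<alpha>" "\<alpha> < 2" and t0: "t0 \<in> T" and k: "0 < k"
    and L: "\<And>t. t \<in> T \<Longrightarrow> in_L \<alpha> \<nu> (f t)"
    and one: "\<And>t. t \<in> T \<Longrightarrow> (\<integral>\<omega>. iexp (V t \<omega>) \<partial>Q) = of_real (exp (- (k * (\<integral>s. norm (f t s) powr \<alpha> \<partial>\<nu>))))"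
    and two: "\<And>s t. s \<in> T \<Longrightarrow> t \<in> T \<Longrightarrow> s \<noteq> t \<Longrightarrow> (\<integral>\<omega>. iexp (V s \<omega> - V t \<omega>) \<partial>Q)
        = of_real (exp (- (k * (\<integral>x. norm (f s x - f t x) powr \<alpha> \<partial>\<nu>))))"
    and stat: "\<And>s t. s \<in> T \<Longrightarrow> t \<in> T \<Longrightarrow> (\<integral>\<omega>. iexp (V s \<omega>) \<partial>Q) = (\<integral>\<omega>. iexp (V t \<omega>) \<partial>Q)"
    and inv: "invariant_weight T \<nu> f"
  shows "increment_gap T Q V"
proof -
  interpret prob_space Q by fact
  define c where "c = (\<integral>s. norm (f t0 s) powr \<alpha> \<partial>\<nu>)"
  define d where "d s t = k * (\<integral>x. norm (f s x - f t x) powr \<alpha> \<partial>\<nu>)" for s t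
  have c: "(\<integral>s. norm (f t s) powr \<alpha> \<partial>\<nu>) = c" if "t \<in> T" for t
    using stat[OF that t0] k unfolding one[OF that] one[OF t0] c_def
    by (simp only: of_real_eq_iff exp_inj_iff neg_equal_iff_equal mult_cancel_left) auto
  have "0 \<le> c" unfolding c_def by simp
  have d: "(\<integral>\<omega>. iexp (V s \<omega> - V t \<omega>) \<partial>Q) = of_real (exp (- d s t))" if "s \<in> T" "t \<in> T" for s t
  proof (cases "s = t")
    case True
    then show ?thesis by (simp add: d_def prob_space)
  qed (use two[OF that] in \<open>simp add: d_def\<close>)
  have "\<exists>\<delta>\<ge>0. (c \<noteq> 0 \<longrightarrow> 0 < \<delta>) \<and> (\<forall>K w. convex_weights T K w \<longrightarrow>
      (\<Sum>i\<in>K. \<Sum>j\<in>K. w i * w j * (\<integral>s. norm (f i s - f j s) powr \<alpha> \<partial>\<nu>)) \<le> 2 * c - \<delta>)"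
    by (rule uniform_gap[OF \<alpha> _ _ inv t0]) (use L c in auto)
  then obtain \<delta> where "0 \<le> \<delta>" "c \<noteq> 0 \<longrightarrow> 0 < \<delta>" and
    \<delta>: "\<forall>K w. convex_weights T K w \<longrightarrow>
      (\<Sum>i\<in>K. \<Sum>j\<in>K. w i * w j * (\<integral>s. norm (f i s - f j s) powr \<alpha> \<partial>\<nu>)) \<le> 2 * c - \<delta>"
    by (elim exE conjE that)
  show ?thesis
    unfolding increment_gap_def
  proof (rule exI[of _ "k * c"], rule exI[of _ d], rule exI[of _ "k * \<delta>"], intro conjI ballI allI impI)
    fix K w assume "convex_weights T K w"
    then have "k * (\<Sum>i\<in>K. \<Sum>j\<in>K. w i * w j * (\<integral>s. norm (f i s - f j s) powr \<alpha> \<partial>\<nu>)) \<le> k * (2 * c - \<delta>)"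
      using \<delta> k by (intro mult_left_mono) auto
    also have "k * (\<Sum>i\<in>K. \<Sum>j\<in>K. w i * w j * (\<integral>s. norm (f i s - f j s) powr \<alpha> \<partial>\<nu>)) = (\<Sum>i\<in>K. \<Sum>j\<in>K. w i * w j * d i j)"
      by (simp add: d_def sum_distrib_left mult_ac)
    finally show "(\<Sum>i\<in>K. \<Sum>j\<in>K. w i * w j * d i j) \<le> 2 * (k * c) - k * \<delta>"
      by (simp add: algebra_simps)
  next
    show "(\<integral>\<omega>. iexp (V t \<omega>) \<partial>Q) = of_real (exp (- (k * c)))" if "t \<in> T" for t
      using one[OF that] c[OF that] by simp
  qed (use k d \<open>0 \<le> c\<close> \<open>0 \<le> \<delta>\<close> \<open>c \<noteq> 0 \<longrightarrow> 0 < \<delta>\<close> in auto)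
qed

section \<open>Transfer through finite-dimensional distributions, and the independent sum\<close>

lemma same_fdd_integral:
  fixes X :: "real \<Rightarrow> 'w \<Rightarrow> 'a::topological_space" and F :: "(real \<Rightarrow> 'a) \<Rightarrow> complex"
  assumes "same_fdd T P X Q Y" and K: "finite K" "K \<subseteq> T"
    and X: "\<And>t. t \<in> T \<Longrightarrow> X t \<in> borel_measurable P" and Y: "\<And>t. t \<in> T \<Longrightarrow> Y t \<in> borel_measurable Q"
    and F: "F \<in> borel_measurable (\<Pi>\<^sub>M t\<in>K. borel)"
  shows "(\<integral>\<omega>. F (sample_path K X \<omega>) \<partial>P) = (\<integral>\<omega>. F (sample_path K Y \<omega>) \<partial>Q)"
proof -
  have m: "sample_path K X \<in> measurable P (\<Pi>\<^sub>M t\<in>K. borel)" "sample_path K Y \<in> measurable Q (\<Pi>\<^sub>M t\<in>K. borel)"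
    using X Y K by (auto intro!: measurable_sample_path)
  have "(\<integral>\<omega>. F (sample_path K X \<omega>) \<partial>P) = (\<integral>x. F x \<partial>distr P (\<Pi>\<^sub>M t\<in>K. borel) (sample_path K X))"
    using m F by (intro integral_distr[symmetric])
  also have "\<dots> = (\<integral>x. F x \<partial>distr Q (\<Pi>\<^sub>M t\<in>K. borel) (sample_path K Y))"
    using assms(1) K by (simp add: same_fdd_def)
  also have "\<dots> = (\<integral>\<omega>. F (sample_path K Y \<omega>) \<partial>Q)"
    using m F by (intro integral_distr)
  finally show ?thesis .
qed

lemma same_fdd_iexp:
  fixes X :: "real \<Rightarrow> 'w \<Rightarrow> 'a::topological_space"
  assumes fdd: "same_fdd T P X Q Y"
    and X: "\<And>t. t \<in> T \<Longrightarrow> X t \<in> borel_measurable P" and Y: "\<And>t. t \<in> T \<Longrightarrow> Y t \<in> borel_measurable Q"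
    and l[measurable]: "l \<in> borel_measurable borel"
  shows "t \<in> T \<Longrightarrow> (\<integral>\<omega>. iexp (l (X t \<omega>)) \<partial>P) = (\<integral>\<omega>. iexp (l (Y t \<omega>)) \<partial>Q)"
    and "s \<in> T \<Longrightarrow> t \<in> T \<Longrightarrow> (\<integral>\<omega>. iexp (l (X s \<omega>) - l (X t \<omega>)) \<partial>P) = (\<integral>\<omega>. iexp (l (Y s \<omega>) - l (Y t \<omega>)) \<partial>Q)"
proof -
  show "(\<integral>\<omega>. iexp (l (X t \<omega>)) \<partial>P) = (\<integral>\<omega>. iexp (l (Y t \<omega>)) \<partial>Q)" if "t \<in> T"
  proof -
    have "(\<lambda>x. iexp (l (x t))) \<in> borel_measurable (\<Pi>\<^sub>M t\<in>{t}. borel)" by measurable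
    from same_fdd_integral[OF fdd _ _ X Y this] that show ?thesis by (simp add: sample_path_def)
  qed
  show "(\<integral>\<omega>. iexp (l (X s \<omega>) - l (X t \<omega>)) \<partial>P) = (\<integral>\<omega>. iexp (l (Y s \<omega>) - l (Y t \<omega>)) \<partial>Q)" if "s \<in> T" "t \<in> T"
  proof -
    have "(\<lambda>x. iexp (l (x s) - l (x t))) \<in> borel_measurable (\<Pi>\<^sub>M t\<in>{s, t}. borel)" by measurable
    from same_fdd_integral[OF fdd _ _ X Y this] that show ?thesis by (simp add: sample_path_def)
  qed
qed

text \<open>Events of the image process are pulled back along the coordinatewise map, which commutes
  with shifts. It allows passing to real parts.\<close>

lemma ergodic_compose:
  fixes X :: "real \<Rightarrow> 'w \<Rightarrow> 'a::topological_space" and l :: "'a \<Rightarrow> 'b::topological_space"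
  assumes erg: "ergodic T P X" and T: "\<And>s t. s \<in> T \<Longrightarrow> t \<in> T \<Longrightarrow> s + t \<in> T"
    and l[measurable]: "l \<in> borel_measurable borel"
  shows "ergodic T P (\<lambda>t \<omega>. l (X t \<omega>))"
  unfolding ergodic_def
proof (intro ballI impI)
  fix A assume A: "A \<in> sets (\<Pi>\<^sub>M t\<in>T. (borel :: 'b measure))"
    and inv: "\<forall>h\<in>T. AE \<omega> in P. sample_path T (\<lambda>t \<omega>. l (X (t + h) \<omega>)) \<omega> \<in> A \<longleftrightarrow> sample_path T (\<lambda>t \<omega>. l (X t \<omega>)) \<omega> \<in> A"
  define m where "m x = (\<lambda>t\<in>T. l (x t))" for x :: "real \<Rightarrow> 'a"
  define B where "B = m -` A \<inter> space (\<Pi>\<^sub>M t\<in>T. (borel :: 'a measure))"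
  have "m \<in> measurable (\<Pi>\<^sub>M t\<in>T. borel) (\<Pi>\<^sub>M t\<in>T. borel)"
    unfolding m_def by measurable
  then have B: "B \<in> sets (\<Pi>\<^sub>M t\<in>T. borel)"
    unfolding B_def using A by (rule measurable_sets)
  have mem: "sample_path T Z \<omega> \<in> B \<longleftrightarrow> sample_path T (\<lambda>t \<omega>. l (Z t \<omega>)) \<omega> \<in> A"
    for Z :: "real \<Rightarrow> 'w \<Rightarrow> 'a" and \<omega>
  proof -
    have "m (sample_path T Z \<omega>) = sample_path T (\<lambda>t \<omega>. l (Z t \<omega>)) \<omega>"
      by (auto simp: m_def sample_path_def fun_eq_iff)
    then show ?thesis by (simp add: B_def)
  qed
  show "measure P {\<omega> \<in> space P. sample_path T (\<lambda>t \<omega>. l (X t \<omega>)) \<omega> \<in> A} \<in> {0, 1}"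
    using erg[unfolded ergodic_def, rule_format, OF B] inv by (simp add: mem)
qed

text \<open>The map \<open>l\<close> is the identity or the real part; additivity lets the
  characteristic functions of values and increments factor over the independent summands.
  Nontriviality at one time gives \<open>c1 + c2 \<noteq> 0\<close>, so at least one of the two gaps
  is positive.\<close>

lemma not_ergodic_of_sum:
  fixes X :: "real \<Rightarrow> 'w \<Rightarrow> 'a::euclidean_space" and Y1 Y2 :: "real \<Rightarrow> 'v \<Rightarrow> 'a" and l :: "'a \<Rightarrow> real"
  assumes T: "\<And>s t. s \<in> T \<Longrightarrow> t \<in> T \<Longrightarrow> s + t \<in> T" "T \<noteq> {}"
    and X: "stochastic_process T P X" "stationary T P X"
    and Y1: "stochastic_process T Q Y1" and Y2: "stochastic_process T Q Y2"
    and indep: "prob_space.indep_var Q (\<Pi>\<^sub>M t\<in>T. borel) (sample_path T Y1) (\<Pi>\<^sub>M t\<in>T. borel) (sample_path T Y2)"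
    and fdd: "same_fdd T P X Q (\<lambda>t \<omega>. Y1 t \<omega> + Y2 t \<omega>)"
    and l: "l \<in> borel_measurable borel" "\<And>x y. l (x + y) = l x + l y"
    and gap1: "increment_gap T Q (\<lambda>t \<omega>. l (Y1 t \<omega>))" and gap2: "increment_gap T Q (\<lambda>t \<omega>. l (Y2 t \<omega>))"
    and nontriv: "t0 \<in> T" "(\<integral>\<omega>. iexp (l (X t0 \<omega>)) \<partial>P) \<noteq> 1"
  shows "\<not> ergodic T P X"
proof
  assume erg: "ergodic T P X"
  interpret Q: prob_space Q using Y1 by (simp add: stochastic_process_def)
  have P: "prob_space P" using X by (simp add: stochastic_process_def)
  have Xm: "\<And>t. t \<in> T \<Longrightarrow> X t \<in> borel_measurable P" using X by (simp add: stochastic_process_def)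
  have Ym[measurable]: "\<And>t. t \<in> T \<Longrightarrow> Y1 t \<in> borel_measurable Q" "\<And>t. t \<in> T \<Longrightarrow> Y2 t \<in> borel_measurable Q"
    using Y1 Y2 by (simp_all add: stochastic_process_def)
  note [measurable] = l(1)
  have Sm: "(\<lambda>\<omega>. Y1 t \<omega> + Y2 t \<omega>) \<in> borel_measurable Q" if "t \<in> T" for t
    using that by measurable
  have indep_int: "(\<integral>\<omega>. F (sample_path T Y1 \<omega>) * F (sample_path T Y2 \<omega>) \<partial>Q)
      = (\<integral>\<omega>. F (sample_path T Y1 \<omega>) \<partial>Q) * (\<integral>\<omega>. F (sample_path T Y2 \<omega>) \<partial>Q)"
    if F: "F \<in> borel_measurable (\<Pi>\<^sub>M t\<in>T. borel)" and bdd: "\<And>x. cmod (F x) \<le> 1" for F :: "(real \<Rightarrow> 'a) \<Rightarrow> complex"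
  proof -
    have "Q.indep_var borel (F \<circ> sample_path T Y1) borel (F \<circ> sample_path T Y2)"
      by (rule Q.indep_var_compose[OF indep F F])
    moreover have "integrable Q (F \<circ> sample_path T Y)" if "\<And>t. t \<in> T \<Longrightarrow> Y t \<in> borel_measurable Q" for Y
      using bdd measurable_comp[OF measurable_sample_path[OF that] F]
      by (intro Q.integrable_const_bound[where B=1]) auto
    ultimately show ?thesis
      using Q.indep_var_lebesgue_integral[of "F \<circ> sample_path T Y1" "F \<circ> sample_path T Y2"] Ym
      by (simp add: comp_def)
  qed
  have comp: "(\<lambda>x. x t) \<in> borel_measurable (\<Pi>\<^sub>M t\<in>T. (borel :: 'a measure))" if "t \<in> T" for t
    using that by (rule measurable_component_singleton)
  have sum1: "(\<integral>\<omega>. iexp (l (X t \<omega>)) \<partial>P) = (\<integral>\<omega>. iexp (l (Y1 t \<omega>)) \<partial>Q) * (\<integral>\<omega>. iexp (l (Y2 t \<omega>)) \<partial>Q)" if t: "t \<in> T" for t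
  proof -
    have "(\<integral>\<omega>. iexp (l (X t \<omega>)) \<partial>P) = (\<integral>\<omega>. iexp (l (Y1 t \<omega> + Y2 t \<omega>)) \<partial>Q)"
      by (rule same_fdd_iexp(1)[OF fdd Xm Sm l(1) t])
    also have "\<dots> = (\<integral>\<omega>. iexp (l (Y1 t \<omega>)) * iexp (l (Y2 t \<omega>)) \<partial>Q)"
      by (simp add: l(2) distrib_left exp_add)
    also have "\<dots> = (\<integral>\<omega>. iexp (l (Y1 t \<omega>)) \<partial>Q) * (\<integral>\<omega>. iexp (l (Y2 t \<omega>)) \<partial>Q)"
      using indep_int[of "\<lambda>x. iexp (l (x t))"] comp[OF t] t by (simp add: sample_path_def)
    finally show ?thesis .
  qed
  have sum2: "(\<integral>\<omega>. iexp (l (X s \<omega>) - l (X t \<omega>)) \<partial>P)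
      = (\<integral>\<omega>. iexp (l (Y1 s \<omega>) - l (Y1 t \<omega>)) \<partial>Q) * (\<integral>\<omega>. iexp (l (Y2 s \<omega>) - l (Y2 t \<omega>)) \<partial>Q)"
    if st: "s \<in> T" "t \<in> T" for s t
  proof -
    have "(\<integral>\<omega>. iexp (l (X s \<omega>) - l (X t \<omega>)) \<partial>P) = (\<integral>\<omega>. iexp (l (Y1 s \<omega> + Y2 s \<omega>) - l (Y1 t \<omega> + Y2 t \<omega>)) \<partial>Q)"
      by (rule same_fdd_iexp(2)[OF fdd Xm Sm l(1) st])
    also have "\<dots> = (\<integral>\<omega>. iexp (l (Y1 s \<omega>) - l (Y1 t \<omega>)) * iexp (l (Y2 s \<omega>) - l (Y2 t \<omega>)) \<partial>Q)"
      by (simp add: l(2) algebra_simps flip: exp_add)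
    also have "\<dots> = (\<integral>\<omega>. iexp (l (Y1 s \<omega>) - l (Y1 t \<omega>)) \<partial>Q) * (\<integral>\<omega>. iexp (l (Y2 s \<omega>) - l (Y2 t \<omega>)) \<partial>Q)"
      using indep_int[of "\<lambda>x. iexp (l (x s) - l (x t))"] comp[OF st(1)] comp[OF st(2)] st by (simp add: sample_path_def)
    finally show ?thesis .
  qed
  obtain c1 d1 \<delta>1 where g1: "0 \<le> c1" "0 \<le> \<delta>1" "c1 \<noteq> 0 \<longrightarrow> 0 < \<delta>1"
     "\<forall>t\<in>T. (\<integral>\<omega>. iexp (l (Y1 t \<omega>)) \<partial>Q) = of_real (exp (- c1))"
     "\<forall>s\<in>T. \<forall>t\<in>T. (\<integral>\<omega>. iexp (l (Y1 s \<omega>) - l (Y1 t \<omega>)) \<partial>Q) = of_real (exp (- d1 s t))"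
     "\<forall>K w. convex_weights T K w \<longrightarrow> (\<Sum>i\<in>K. \<Sum>j\<in>K. w i * w j * d1 i j) \<le> 2 * c1 - \<delta>1"
    using gap1 unfolding increment_gap_def by (elim exE conjE that)
  obtain c2 d2 \<delta>2 where g2: "0 \<le> c2" "0 \<le> \<delta>2" "c2 \<noteq> 0 \<longrightarrow> 0 < \<delta>2"
     "\<forall>t\<in>T. (\<integral>\<omega>. iexp (l (Y2 t \<omega>)) \<partial>Q) = of_real (exp (- c2))"
     "\<forall>s\<in>T. \<forall>t\<in>T. (\<integral>\<omega>. iexp (l (Y2 s \<omega>) - l (Y2 t \<omega>)) \<partial>Q) = of_real (exp (- d2 s t))"
     "\<forall>K w. convex_weights T K w \<longrightarrow> (\<Sum>i\<in>K. \<Sum>j\<in>K. w i * w j * d2 i j) \<le> 2 * c2 - \<delta>2"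
    using gap2 unfolding increment_gap_def by (elim exE conjE that)
  define d where "d s t = d1 s t + d2 s t" for s t
  have c: "(\<integral>\<omega>. iexp (l (X t \<omega>)) \<partial>P) = of_real (exp (- (c1 + c2)))" if "t \<in> T" for t
    unfolding sum1[OF that] bspec[OF g1(4) that] bspec[OF g2(4) that] by (simp flip: exp_add of_real_mult)
  have d: "(\<integral>\<omega>. iexp (l (X s \<omega>) - l (X t \<omega>)) \<partial>P) = of_real (exp (- d s t))" if "s \<in> T" "t \<in> T" for s t
    unfolding sum2[OF that] bspec[OF bspec[OF g1(5) that(1)] that(2)] bspec[OF bspec[OF g2(5) that(1)] that(2)] d_def
    by (simp flip: exp_add of_real_mult)
  have "\<not> ergodic T P (\<lambda>t \<omega>. l (X t \<omega>))"
  proof (rule not_ergodic_if_gap[OF P _ T c d])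
    \<comment> \<open>Read off from the stationarity of \<open>X\<close>, since a real exponent is
      determined by its exponential.\<close>
    show "d (s + h) (t + h) = d s t" if "s \<in> T" "t \<in> T" "h \<in> T" for s t h
    proof -
      have "same_fdd T P (\<lambda>t. X (t + h)) P X" using X(2) that(3) by (simp add: stationary_def)
      from same_fdd_iexp(2)[OF this _ Xm l(1) that(1,2)]
      have "(\<integral>\<omega>. iexp (l (X (s + h) \<omega>) - l (X (t + h) \<omega>)) \<partial>P) = (\<integral>\<omega>. iexp (l (X s \<omega>) - l (X t \<omega>)) \<partial>P)"
        using Xm T(1) that(3) by blast
      then show ?thesis
        unfolding d[OF that(1,2)] d[OF T(1)[OF that(1,3)] T(1)[OF that(2,3)]]
        by (simp only: of_real_eq_iff exp_inj_iff neg_equal_iff_equal)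
    qed
    show "(\<Sum>i\<in>K. \<Sum>j\<in>K. w i * w j * d i j) \<le> 2 * (c1 + c2) - (\<delta>1 + \<delta>2)" if "convex_weights T K w" for K w
      using g1(6)[rule_format, OF that] g2(6)[rule_format, OF that]
      by (simp add: d_def distrib_left sum.distrib)
    have "c1 + c2 \<noteq> 0"
      using c[OF nontriv(1)] nontriv(2) by auto
    then show "0 < \<delta>1 + \<delta>2" using g1(1-3) g2(1-3) by (cases "c1 = 0") auto
    show "(\<lambda>\<omega>. l (X t \<omega>)) \<in> borel_measurable P" if "t \<in> T" for t
      using Xm[OF that] by measurable
  qed auto
  with ergodic_compose[OF erg T(1) l(1)] show False by blast
qed

section \<open>Degenerate characteristic functions and positivity of c0\<close>

text \<open>The mean of \<open>1 - cos (r * Z)\<close> is 0, so the cosine is 1 almost surely, and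
  this holds at once for the countably many r = 1 / (n + 1). At a nonzero value of Z a large n gives
  an argument of modulus in (0, 1], where the cosine is below 1.\<close>

lemma (in prob_space) AE_eq_0_if_char_eq_1:
  fixes Z :: "'a \<Rightarrow> real"
  assumes Z[measurable]: "Z \<in> borel_measurable M" and one: "\<And>r::real. (\<integral>\<omega>. iexp (r * Z \<omega>) \<partial>M) = 1"
  shows "AE \<omega> in M. Z \<omega> = 0"
proof -
  have "AE \<omega> in M. cos (1 / real (Suc n) * Z \<omega>) = 1" for n
  proof -
    let ?r = "1 / real (Suc n)"
    have ii: "integrable M (\<lambda>\<omega>. iexp (?r * Z \<omega>))"
      by (rule integrable_const_bound[where B=1]) auto
    have int: "integrable M (\<lambda>\<omega>. cos (?r * Z \<omega>))"
      by (rule integrable_const_bound[where B=1]) auto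
    have "(\<integral>\<omega>. cos (?r * Z \<omega>) \<partial>M) = (\<integral>\<omega>. Re (iexp (?r * Z \<omega>)) \<partial>M)"
      by (simp add: Re_exp)
    also have "\<dots> = 1"
      using ii one[of ?r] by (subst integral_Re) auto
    finally have "(\<integral>\<omega>. 1 - cos (?r * Z \<omega>) \<partial>M) = 0" using int by (simp add: prob_space)
    then have "AE \<omega> in M. 1 - cos (?r * Z \<omega>) = 0"
      using int by (subst (asm) integral_nonneg_eq_0_iff_AE) auto
    then show ?thesis by (rule AE_mp) auto
  qed
  then have "AE \<omega> in M. \<forall>n. cos (1 / real (Suc n) * Z \<omega>) = 1"
    by (subst AE_all_countable) blast
  then show ?thesis
  proof (rule AE_mp, intro AE_I2 impI)
    fix \<omega> assume *: "\<forall>n. cos (1 / real (Suc n) * Z \<omega>) = 1"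
    show "Z \<omega> = 0"
    proof (rule ccontr)
      assume "Z \<omega> \<noteq> 0"
      obtain n where n: "\<bar>Z \<omega>\<bar> < real n" using reals_Archimedean2 by blast
      define x where "x = \<bar>1 / real (Suc n) * Z \<omega>\<bar>"
      have "0 < x" "x \<le> 1" using n \<open>Z \<omega> \<noteq> 0\<close> by (auto simp: x_def abs_mult)
      then have "cos x < cos 0" using pi_gt3 by (intro cos_monotone_0_pi) auto
      then show False
        using spec[OF *, of n] by (simp only: x_def cos_abs_real cos_zero less_irrefl)
    qed
  qed
qed

text \<open>The integrand is positive on (0, 1), a set of positive measure. Strict positivity is
  what \<open>increment_gapI\<close> asks of its factor.\<close>

lemma c0_pos:
  assumes "0 < \<alpha>"
  shows "0 < c0 \<alpha>"
proof -
  let ?f = "\<lambda>\<phi>::real. indicator {0..2 * pi} \<phi> *\<^sub>R \<bar>cos \<phi>\<bar> powr \<alpha>"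
  have nn: "AE \<phi> in lborel. 0 \<le> ?f \<phi>" by auto
  have int: "integrable lborel ?f"
  proof (rule Bochner_Integration.integrable_bound)
    show "integrable lborel (\<lambda>x::real. indicator {0..2 * pi} x :: real)" by simp
    have "\<bar>cos \<phi>\<bar> powr \<alpha> \<le> 1" for \<phi>
      using powr_mono2[of \<alpha> "\<bar>cos \<phi>\<bar>" 1] assms by simp
    then show "AE x in lborel. norm (?f x) \<le> norm (indicator {0..2 * pi} x :: real)"
      by (auto simp: indicator_def)
  qed measurable
  have "integral\<^sup>L lborel ?f \<noteq> 0"
  proof
    assume "integral\<^sup>L lborel ?f = 0"
    then have "AE \<phi> in lborel. ?f \<phi> = 0"
      using integral_nonneg_eq_0_iff_AE[OF int nn] by simp
    then have "AE \<phi> in lborel. \<phi> \<notin> {0<..<1::real}"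
    proof (rule AE_mp, intro AE_I2 impI)
      fix \<phi> :: real assume *: "?f \<phi> = 0"
      show "\<phi> \<notin> {0<..<1}"
      proof
        assume \<phi>: "\<phi> \<in> {0<..<1}"
        then have "cos \<phi> > 0" using pi_gt3 by (intro cos_gt_zero_pi) auto
        moreover have "\<phi> \<le> 2 * pi" using \<phi> pi_gt3 by auto
        ultimately show False using * \<phi> by (auto simp: indicator_def)
      qed
    qed
    then have "{0<..<1::real} \<in> null_sets lborel"
      by (subst AE_iff_null_sets) auto
    then show False by (simp add: null_sets_def)
  qed
  moreover have "0 \<le> integral\<^sup>L lborel ?f" using nn by (rule integral_nonneg_AE)
  ultimately have "0 < integral\<^sup>L lborel ?f" by linarith
  then show ?thesis
    unfolding c0_def set_lebesgue_integral_def by (intro mult_pos_pos) auto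
qed

section \<open>The real and the complex case\<close>

lemma increment_gap_real:
  assumes \<alpha>: "0 < \<alpha>" "\<alpha> < 2" and T: "\<And>s t. s \<in> T \<Longrightarrow> t \<in> T \<Longrightarrow> s + t \<in> T" "0 \<in> T"
    and Y: "stationary_sas_real T \<alpha> Q Y" and f: "stable_integral_real T \<alpha> \<nu> f Q Y"
    and inv: "invariant_weight T \<nu> f"
  shows "increment_gap T Q Y"
proof (rule increment_gapI[OF _ \<alpha> T(2) zero_less_one _ _ _ _ inv])
  have proc: "stochastic_process T Q Y" "stationary T Q Y"
    using Y by (auto simp: stationary_sas_real_def)
  then show "prob_space Q" by (simp add: stochastic_process_def)
  have Ym: "Y t \<in> borel_measurable Q" if "t \<in> T" for t
    using proc that by (simp add: stochastic_process_def)
  show "in_L \<alpha> \<nu> (f t)" if "t \<in> T" for t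
    using f that by (simp add: stable_integral_real_def)
  have ch: "(\<integral>\<omega>. iexp (\<Sum>t\<in>K. \<theta> t * Y t \<omega>) \<partial>Q)
        = complex_of_real (exp (- (\<integral>s. \<bar>\<Sum>t\<in>K. \<theta> t * f t s\<bar> powr \<alpha> \<partial>\<nu>)))"
    if "finite K" "K \<subseteq> T" for K and \<theta> :: "real \<Rightarrow> real"
    using f that by (simp add: stable_integral_real_def)
  show "(\<integral>\<omega>. iexp (Y t \<omega>) \<partial>Q) = of_real (exp (- (1 * (\<integral>s. norm (f t s) powr \<alpha> \<partial>\<nu>))))"
    if "t \<in> T" for t
    using ch[of "{t}" "\<lambda>_. 1"] that by simp
  show "(\<integral>\<omega>. iexp (Y s \<omega> - Y t \<omega>) \<partial>Q)
      = of_real (exp (- (1 * (\<integral>x. norm (f s x - f t x) powr \<alpha> \<partial>\<nu>))))"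
    if "s \<in> T" "t \<in> T" "s \<noteq> t" for s t
    using ch[of "{s, t}" "\<lambda>x. if x = s then 1 else - 1"] that by simp
  have stat: "(\<integral>\<omega>. iexp (Y s \<omega>) \<partial>Q) = (\<integral>\<omega>. iexp (Y 0 \<omega>) \<partial>Q)" if "s \<in> T" for s
  proof -
    have "same_fdd T Q (\<lambda>t. Y (t + s)) Q Y" using proc(2) that by (simp add: stationary_def)
    from same_fdd_iexp(1)[OF this _ Ym, of "\<lambda>x. x" 0] show ?thesis
      using Ym T that by simp
  qed
  show "(\<integral>\<omega>. iexp (Y s \<omega>) \<partial>Q) = (\<integral>\<omega>. iexp (Y t \<omega>) \<partial>Q)" if "s \<in> T" "t \<in> T" for s t
    using stat[OF that(1)] stat[OF that(2)] by simp
qed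

text \<open>For the real coefficients 1 and -1 the conjugations disappear, and the complex
  characteristic function becomes that of the real part and of its increments.\<close>

lemma increment_gap_complex:
  assumes \<alpha>: "0 < \<alpha>" "\<alpha> < 2" and T: "\<And>s t. s \<in> T \<Longrightarrow> t \<in> T \<Longrightarrow> s + t \<in> T" "0 \<in> T"
    and Y: "stationary_sas_complex T \<alpha> Q Y" and f: "stable_integral_complex T \<alpha> \<nu> f Q Y"
    and inv: "invariant_weight T \<nu> f"
  shows "increment_gap T Q (\<lambda>t \<omega>. Re (Y t \<omega>))"
proof (rule increment_gapI[OF _ \<alpha> T(2) c0_pos[OF \<alpha>(1)] _ _ _ _ inv])
  have proc: "stochastic_process T Q Y" "stationary T Q Y"
    using Y by (auto simp: stationary_sas_complex_def)
  then show "prob_space Q" by (simp add: stochastic_process_def)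
  have Ym: "Y t \<in> borel_measurable Q" if "t \<in> T" for t
    using proc that by (simp add: stochastic_process_def)
  show "in_L \<alpha> \<nu> (f t)" if "t \<in> T" for t
    using f that by (simp add: stable_integral_complex_def)
  have ch: "(\<integral>\<omega>. iexp (\<Sum>t\<in>K. Re (cnj (\<theta> t) * Y t \<omega>)) \<partial>Q)
      = complex_of_real (exp (- (c0 \<alpha> * (\<integral>s. cmod (\<Sum>t\<in>K. cnj (\<theta> t) * f t s) powr \<alpha> \<partial>\<nu>))))"
    if "finite K" "K \<subseteq> T" for K and \<theta> :: "real \<Rightarrow> complex"
    using f that by (simp add: stable_integral_complex_def)
  show "(\<integral>\<omega>. iexp (Re (Y t \<omega>)) \<partial>Q) = of_real (exp (- (c0 \<alpha> * (\<integral>s. norm (f t s) powr \<alpha> \<partial>\<nu>))))"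
    if "t \<in> T" for t
    using ch[of "{t}" "\<lambda>_. 1"] that by simp
  show "(\<integral>\<omega>. iexp (Re (Y s \<omega>) - Re (Y t \<omega>)) \<partial>Q)
      = of_real (exp (- (c0 \<alpha> * (\<integral>x. norm (f s x - f t x) powr \<alpha> \<partial>\<nu>))))"
    if "s \<in> T" "t \<in> T" "s \<noteq> t" for s t
    using ch[of "{s, t}" "\<lambda>x. if x = s then 1 else - 1"] that by simp
  have stat: "(\<integral>\<omega>. iexp (Re (Y s \<omega>)) \<partial>Q) = (\<integral>\<omega>. iexp (Re (Y 0 \<omega>)) \<partial>Q)" if "s \<in> T" for s
  proof -
    have "same_fdd T Q (\<lambda>t. Y (t + s)) Q Y" using proc(2) that by (simp add: stationary_def)
    from same_fdd_iexp(1)[OF this _ Ym, of Re 0] show ?thesis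
      using Ym T that by simp
  qed
  show "(\<integral>\<omega>. iexp (Re (Y s \<omega>)) \<partial>Q) = (\<integral>\<omega>. iexp (Re (Y t \<omega>)) \<partial>Q)" if "s \<in> T" "t \<in> T" for s t
    using stat[OF that(1)] stat[OF that(2)] by simp
qed

text \<open>The kernel is 1 at the point 1; at the point 2 it is a sign for integer times and 0 for
  real times. Either way its modulus is constant in t.\<close>

lemma harmonizable_part_gap_real:
  assumes \<alpha>: "0 < \<alpha>" "\<alpha> < 2" and T: "T = \<int> \<or> T = UNIV"
    and Y: "stationary_sas_real T \<alpha> Q Y" and h: "harmonizable_part_real T \<alpha> Q Y"
  shows "increment_gap T Q Y"
proof -
  obtain \<mu> :: "nat measure" where \<mu>: "finite_measure \<mu>" "space \<mu> = {1, 2}"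
    and f: "stable_integral_real T \<alpha> \<mu> (\<lambda>t s. indicator {1} s + alt_sign T t * indicator {2} s) Q Y"
    using h unfolding harmonizable_part_real_def by blast
  have "invariant_weight T \<mu> (\<lambda>t s. indicator {1} s + alt_sign T t * indicator {2} s)"
  proof (rule invariant_weight_if_norm_constant[OF \<mu>(1)])
    fix s t u assume "s \<in> space \<mu>"
    then show "norm (indicator {1} s + alt_sign T t * indicator {2} s)
        = norm (indicator {1} s + alt_sign T u * indicator {2} s :: real)"
      unfolding \<mu>(2) by (auto simp: alt_sign_def indicator_def norm_power_int)
  qed
  from increment_gap_real[OF \<alpha> time_set_add[OF T] _ Y f this] T show ?thesis by auto
qed

lemma harmonizable_part_gap_complex:
  assumes \<alpha>: "0 < \<alpha>" "\<alpha> < 2" and T: "T = \<int> \<or> T = UNIV"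
    and Y: "stationary_sas_complex T \<alpha> Q Y" and h: "harmonizable_part_complex T \<alpha> Q Y"
  shows "increment_gap T Q (\<lambda>t \<omega>. Re (Y t \<omega>))"
proof -
  obtain \<mu> :: "real measure" where \<mu>: "finite_measure \<mu>"
    and f: "stable_integral_complex T \<alpha> \<mu> (\<lambda>t x. iexp (t * x)) Q Y"
    using h unfolding harmonizable_part_complex_def by blast
  have "invariant_weight T \<mu> (\<lambda>t x. iexp (t * x))"
    by (rule invariant_weight_if_norm_constant[OF \<mu>(1)]) (simp only: norm_iexp)
  from increment_gap_complex[OF \<alpha> time_set_add[OF T] _ Y f this] T show ?thesis by auto
qed

lemma cyclic_part_gap_real:
  assumes \<alpha>: "0 < \<alpha>" "\<alpha> < 2" and T: "T = \<int> \<or> T = UNIV"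
    and Y: "stationary_sas_real T \<alpha> Q Y" and h: "cyclic_part_real TYPE('z) T \<alpha> Q Y"
  shows "increment_gap T Q Y"
proof -
  obtain \<sigma> :: "'z measure" and q g b where \<sigma>: "standard_lebesgue_space \<sigma>"
    and q: "q \<in> borel_measurable \<sigma>" "AE z in \<sigma>. q z \<in> time_pos T"
    and g: "in_L \<alpha> (cyclic_space T \<sigma> q) g" and b: "\<forall>z\<in>space \<sigma>. b z \<in> {- 1, 1 :: real}"
    and f: "stable_integral_real T \<alpha> (cyclic_space T \<sigma> q) (cyclic_kernel q b g) Q Y"
    using h unfolding cyclic_part_real_def by blast
  have "invariant_weight T (cyclic_space T \<sigma> q) (cyclic_kernel q b g)"
  proof (rule cyclic_invariant_weight[OF T _ q])
    show "sigma_finite_measure \<sigma>" using \<sigma> by (simp add: standard_lebesgue_space_def)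
    show "norm (b z) = 1" if "z \<in> space \<sigma>" for z using b that by auto
    show "cyclic_kernel q b g t \<in> borel_measurable (cyclic_space T \<sigma> q)" if "t \<in> T" for t
      using f that by (simp add: stable_integral_real_def in_L_def)
  qed (use g in \<open>simp add: in_L_def\<close>)
  from increment_gap_real[OF \<alpha> time_set_add[OF T] _ Y f this] T show ?thesis by auto
qed

lemma cyclic_part_gap_complex:
  assumes \<alpha>: "0 < \<alpha>" "\<alpha> < 2" and T: "T = \<int> \<or> T = UNIV"
    and Y: "stationary_sas_complex T \<alpha> Q Y" and h: "cyclic_part_complex TYPE('z) T \<alpha> Q Y"
  shows "increment_gap T Q (\<lambda>t \<omega>. Re (Y t \<omega>))"
proof -
  obtain \<sigma> :: "'z measure" and q g b where \<sigma>: "standard_lebesgue_space \<sigma>"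
    and q: "q \<in> borel_measurable \<sigma>" "AE z in \<sigma>. q z \<in> time_pos T"
    and g: "in_L \<alpha> (cyclic_space T \<sigma> q) g" and b: "\<forall>z\<in>space \<sigma>. cmod (b z) = 1"
    and f: "stable_integral_complex T \<alpha> (cyclic_space T \<sigma> q) (cyclic_kernel q b g) Q Y"
    using h unfolding cyclic_part_complex_def by blast
  have "invariant_weight T (cyclic_space T \<sigma> q) (cyclic_kernel q b g)"
  proof (rule cyclic_invariant_weight[OF T _ q])
    show "sigma_finite_measure \<sigma>" using \<sigma> by (simp add: standard_lebesgue_space_def)
    show "norm (b z) = 1" if "z \<in> space \<sigma>" for z using b that by auto
    show "cyclic_kernel q b g t \<in> borel_measurable (cyclic_space T \<sigma> q)" if "t \<in> T" for t
      using f that by (simp add: stable_integral_complex_def in_L_def)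
  qed (use g in \<open>simp add: in_L_def\<close>)
  from increment_gap_complex[OF \<alpha> time_set_add[OF T] _ Y f this] T show ?thesis by auto
qed

text \<open>The value 1 at u = 1 forces the scale c to be 0, and then the characteristic function is
  1 everywhere.\<close>

lemma sas_real_char_ne_1:
  assumes X: "stochastic_process T P X" "sas_real T \<alpha> P X" and t: "t \<in> T" and ne: "\<not> (AE \<omega> in P. X t \<omega> = 0)"
  shows "(\<integral>\<omega>. iexp (X t \<omega>) \<partial>P) \<noteq> 1"
proof
  assume one: "(\<integral>\<omega>. iexp (X t \<omega>) \<partial>P) = 1"
  interpret prob_space P using X by (simp add: stochastic_process_def)
  from X(2) t have "\<exists>c\<ge>0. \<forall>u. (\<integral>\<omega>. iexp (u * (\<Sum>s\<in>{t}. 1 * X s \<omega>)) \<partial>P) = complex_of_real (exp (- (c * \<bar>u\<bar> powr \<alpha>)))"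
    unfolding sas_real_def by (elim allE[of _ "{t}"] allE[of _ "\<lambda>_. 1"]) simp
  then obtain c where c: "\<And>u. (\<integral>\<omega>. iexp (u * X t \<omega>) \<partial>P) = complex_of_real (exp (- (c * \<bar>u\<bar> powr \<alpha>)))"
    by auto
  have "complex_of_real (exp (- c)) = of_real 1" using c[of 1] one by simp
  then have "exp (- c) = 1" by (simp only: of_real_eq_iff)
  then have "c = 0" by simp
  then have "(\<integral>\<omega>. iexp (u * X t \<omega>) \<partial>P) = 1" for u using c[of u] by simp
  then have "AE \<omega> in P. X t \<omega> = 0"
    using X(1) t by (intro AE_eq_0_if_char_eq_1) (auto simp: stochastic_process_def)
  with ne show False by simp
qed

lemma sas_complex_char_ne_1:
  assumes X: "stochastic_process T P X" "sas_complex T \<alpha> P X" and t: "t \<in> T" and ne: "\<not> (AE \<omega> in P. X t \<omega> = 0)"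
  shows "(\<integral>\<omega>. iexp (Re (X t \<omega>)) \<partial>P) \<noteq> 1"
proof
  assume one: "(\<integral>\<omega>. iexp (Re (X t \<omega>)) \<partial>P) = 1"
  interpret prob_space P using X by (simp add: stochastic_process_def)
  have Xm[measurable]: "X t \<in> borel_measurable P" using X t by (simp add: stochastic_process_def)
  from X(2) t have "\<exists>c\<ge>0. \<forall>u. (\<integral>\<omega>. iexp (Re (cnj u * (\<Sum>s\<in>{t}. cnj 1 * X s \<omega>))) \<partial>P) = complex_of_real (exp (- (c * cmod u powr \<alpha>)))"
    unfolding sas_complex_def by (elim allE[of _ "{t}"] allE[of _ "\<lambda>_. 1"]) simp
  then obtain c where c: "\<And>u. (\<integral>\<omega>. iexp (Re (cnj u * X t \<omega>)) \<partial>P) = complex_of_real (exp (- (c * cmod u powr \<alpha>)))"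
    by auto
  have "complex_of_real (exp (- c)) = of_real 1" using c[of 1] one by simp
  then have "exp (- c) = 1" by (simp only: of_real_eq_iff)
  then have "c = 0" by simp
  then have c: "(\<integral>\<omega>. iexp (Re (cnj u * X t \<omega>)) \<partial>P) = 1" for u using c[of u] by simp
  have "AE \<omega> in P. Re (X t \<omega>) = 0"
    using c[of "of_real _"] by (intro AE_eq_0_if_char_eq_1) auto
  \<comment> \<open>Rotational invariance: the same scale c governs all complex u, and an imaginary
    u picks out the imaginary part.\<close>
  moreover have "AE \<omega> in P. Im (X t \<omega>) = 0"
    using c[of "\<i> * of_real _"] by (intro AE_eq_0_if_char_eq_1) (auto simp: mult.assoc)
  ultimately have "AE \<omega> in P. X t \<omega> = 0"
    by eventually_elim (simp add: complex_eq_iff)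
  with ne show False by simp
qed

lemma stationary_periodic_real_not_ergodic:
  assumes T: "T = \<int> \<or> T = UNIV" and \<alpha>: "0 < \<alpha>" "\<alpha> < 2"
    and X: "stationary_periodic_real TYPE('z) TYPE('v) T \<alpha> P X" and nd: "nondegenerate T P X"
  shows "\<not> ergodic T P X"
proof -
  obtain t where t: "t \<in> T" "\<not> (AE \<omega> in P. X t \<omega> = 0)" using nd by (auto simp: nondegenerate_def)
  have Xs: "stationary_sas_real T \<alpha> P X" using X by (simp add: stationary_periodic_real_def)
  obtain Q :: "'v measure" and Y1 Y2 where
    Y: "stationary_sas_real T \<alpha> Q Y1" "stationary_sas_real T \<alpha> Q Y2"
    and indep: "prob_space.indep_var Q (\<Pi>\<^sub>M t\<in>T. borel) (sample_path T Y1) (\<Pi>\<^sub>M t\<in>T. borel) (sample_path T Y2)"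
    and parts: "harmonizable_part_real T \<alpha> Q Y1" "cyclic_part_real TYPE('z) T \<alpha> Q Y2"
    and fdd: "same_fdd T P X Q (\<lambda>t \<omega>. Y1 t \<omega> + Y2 t \<omega>)"
    using X unfolding stationary_periodic_real_def by blast
  show ?thesis
  proof (rule not_ergodic_of_sum[where l="\<lambda>x. x", OF time_set_add[OF T] _ _ _ _ _ indep fdd])
    show "increment_gap T Q Y1" by (rule harmonizable_part_gap_real[OF \<alpha> T Y(1) parts(1)])
    show "increment_gap T Q Y2" by (rule cyclic_part_gap_real[OF \<alpha> T Y(2) parts(2)])
    show "(\<integral>\<omega>. iexp (X t \<omega>) \<partial>P) \<noteq> 1"
      using Xs t by (intro sas_real_char_ne_1) (auto simp: stationary_sas_real_def)
  qed (use Xs Y t in \<open>auto simp: stationary_sas_real_def\<close>)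
qed

lemma stationary_periodic_complex_not_ergodic:
  assumes T: "T = \<int> \<or> T = UNIV" and \<alpha>: "0 < \<alpha>" "\<alpha> < 2"
    and X: "stationary_periodic_complex TYPE('z) TYPE('v) T \<alpha> P X" and nd: "nondegenerate T P X"
  shows "\<not> ergodic T P X"
proof -
  obtain t where t: "t \<in> T" "\<not> (AE \<omega> in P. X t \<omega> = 0)" using nd by (auto simp: nondegenerate_def)
  have Xs: "stationary_sas_complex T \<alpha> P X" using X by (simp add: stationary_periodic_complex_def)
  obtain Q :: "'v measure" and Y1 Y2 where
    Y: "stationary_sas_complex T \<alpha> Q Y1" "stationary_sas_complex T \<alpha> Q Y2"
    and indep: "prob_space.indep_var Q (\<Pi>\<^sub>M t\<in>T. borel) (sample_path T Y1) (\<Pi>\<^sub>M t\<in>T. borel) (sample_path T Y2)"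
    and parts: "harmonizable_part_complex T \<alpha> Q Y1" "cyclic_part_complex TYPE('z) T \<alpha> Q Y2"
    and fdd: "same_fdd T P X Q (\<lambda>t \<omega>. Y1 t \<omega> + Y2 t \<omega>)"
    using X unfolding stationary_periodic_complex_def by blast
  show ?thesis
  proof (rule not_ergodic_of_sum[where l=Re, OF time_set_add[OF T] _ _ _ _ _ indep fdd])
    show "increment_gap T Q (\<lambda>t \<omega>. Re (Y1 t \<omega>))" by (rule harmonizable_part_gap_complex[OF \<alpha> T Y(1) parts(1)])
    show "increment_gap T Q (\<lambda>t \<omega>. Re (Y2 t \<omega>))" by (rule cyclic_part_gap_complex[OF \<alpha> T Y(2) parts(2)])
    show "(\<integral>\<omega>. iexp (Re (X t \<omega>)) \<partial>P) \<noteq> 1"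
      using Xs t by (intro sas_complex_char_ne_1) (auto simp: stationary_sas_complex_def)
  qed (use Xs Y t in \<open>auto simp: stationary_sas_complex_def\<close>)
qed

theorem theorem4p2:
  fixes T :: "real set" and \<alpha> :: real and P :: "'w measure"
  assumes "T = \<int> \<or> T = UNIV" and "0 < \<alpha>" and "\<alpha> < 2"
  shows "(\<forall>X :: real \<Rightarrow> 'w \<Rightarrow> real.
            stationary_periodic_real TYPE('z) TYPE('v) T \<alpha> P X \<and> nondegenerate T P X
            \<longrightarrow> \<not> ergodic T P X) \<and>
         (\<forall>X :: real \<Rightarrow> 'w \<Rightarrow> complex.
            stationary_periodic_complex TYPE('z) TYPE('v) T \<alpha> P X \<and> nondegenerate T P X
            \<longrightarrow> \<not> ergodic T P X)"
  by (intro conjI allI impI; elim conjE)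
    (erule (1) stationary_periodic_real_not_ergodic[OF assms] stationary_periodic_complex_not_ergodic[OF assms])+

end
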